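(* Let $S$ be a $\sigma$-finite oriented $C^1$-differentiable surface of $\ell^2$ with codimension $\Gamma_{\mathbb N\setminus I_0}$ all of whose local coordinate triples are bounded, and let $D$ be a region with boundary in $S$. Then $|\mathcal A_1|$ defines a $C^1$-differentiable structure on $\partial D$, with respect to which $\partial D$ is a $C^1$-differentiable surface of $\ell^2$ with codimension $\Gamma_{(\mathbb N\setminus I_0)\cup\{i\}}$ for some $i\in I_0$. Moreover, for any two triples $((\partial D)\cap U,\mathbf K\setminus\{k_{i_0}\},f)$ and $((\partial D)\cap U_1,\mathbf K'\setminus\{k'_{i_1}\},g)$ in $\mathcal A_1$ with $(\partial D)\cap U\cap U_1\ne\emptyset$, the transition map $P_{|\mathbf K'|\setminus\{k'_{i_1}\}}P_{|\mathbf K|\setminus\{k_{i_0}\}}^{-1}$ is Fréchet differentiable on its domain, and $$s(\mathbf K\setminus\{k_{i_0}\})\cdot s(\mathbf K'\setminus\{k'_{i_1}\})\cdot\det\Bigl(D\bigl(P_{|\mathbf K'|\setminus\{k'_{i_1}\}}P_{|\mathbf K|\setminus\{k_{i_0}\}}^{-1}\bigr)(P_{|\mathbf K|\setminus\{k_{i_0}\}}\mathbf x)\Bigr)>0$$ for every $\mathbf x\in(\partial D)\cap U\cap U_1$.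
   Context: Basic notation. $\ell^2=\ell^2(\mathbb N)$ is the real Hilbert space with inner product $\langle\cdot,\cdot\rangle$ and standard orthonormal basis $\{\mathbf e_k\}_{k\ge1}$; $\mathbb N=\{1,2,\dots\}$, $\mathbb N_0=\mathbb N\cup\{0\}$. $\{a_i\}_{i\ge1}$ is a fixed sequence of positive numbers with $\sum_i a_i<\infty$. For $I\subset\mathbb N$, $P_I$ is the orthogonal projection of $\ell^2$ onto the closed linear span of $\{\mathbf e_i:i\in I\}$ ($P_\emptyset=0$). $C^1_X(U;Y)$ is the set of continuously Fréchet differentiable maps from an open subset $U$ of a normed space $X$ into a normed space $Y$. Surfaces. For nonempty $I_1,I_2\subset\mathbb N$ write $I_1\sim I_2$ if $I_2=(I_1\setminus K_1)\sqcup K_2$ for some $K_1\subset I_1$, $K_2\subset\mathbb N\setminus I_1$ with $\mathrm{card}\,K_1=\mathrm{card}\,K_2\in\mathbb N_0$. For nonempty $J\subset\mathbb N$, $\Gamma_J=\{I:I\sim J\}$. Fix a nonempty $I_0\subset\mathbb N$. A nonempty $S\subset\ell^2$ is a surface with codimension $\Gamma_{\mathbb N\setminus I_0}$ if each $\mathbf x\in S$ has an open neighborhood $U$ in $\ell^2$, an $I\in\Gamma_{I_0}$, an open neighborhood $U_I$ of $P_I\mathbf x$ in $P_I\ell^2$ and $f\in C^1_{P_I\ell^2}(U_I;P_{\mathbb N\setminus I}\ell^2)$ such that $P_I|_{S\cap U}$ is a homeomorphism onto $U_I$ and $S\cap U=\{\mathbf y+f(\mathbf y):\mathbf y\in U_I\}$.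 Then $(S\cap U,I,f)$ is a local coordinate triple of $S$, and $P_I^{-1}:U_I\to S\cap U$, $\mathbf y\mapsto\mathbf y+f(\mathbf y)$. A $C^1$-differentiable structure on $S$ is a family $\mathcal A$ of local coordinate triples covering $S$; with it $S$ is a $C^1$-differentiable surface. Determinants. For $I_1\sim I_2$, let $\hat I=\{i\in I_1\cap I_2:i\le\max((I_1\setminus I_2)\sqcup(I_2\setminus I_1))\}$ if $I_1\neq I_2$ and $\hat I=\emptyset$ otherwise; write $(I_1\setminus I_2)\sqcup\hat I=\{i_1<\dots<i_t\}$, $(I_2\setminus I_1)\sqcup\hat I=\{j_1<\dots<j_t\}$. For a bounded operator $T:P_{I_1}\ell^2\to P_{I_2}\ell^2$ with $P_{I_1\cap I_2}TP_{I_1\cap I_2}=P_{I_1\cap I_2}$ and $P_{I_1\cap I_2}TP_{I_1\setminus I_2}=0$, put $\det T=1$ if $t=0$ and $\det T=\det(\langle T\mathbf e_{i_q},\mathbf e_{j_p}\rangle)_{1\le p,q\le t}$ otherwise. Derivatives $D(P_{I'}P_I^{-1})(P_I\mathbf x)$, $I'\sim I$, are of this type. Surface measure and boundedness. $n_I(\mathbf x)=\bigl(1+\sum|\det(D_{x_i}f_j(P_I\mathbf x))_{i\in K_1,j\in K_2}|^2\bigr)^{1/2}$, sum over $K_1\subset I$, $K_2\subset\mathbb N\setminus I$ with $\mathrm{card}K_1=\mathrm{card}K_2\in\mathbb N$ (elements in increasing order), $f_j=\langle f,\mathbf e_j\rangle$. $\mu_I$ is the Gaussian product measure $\prod_{i\in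 I}\frac1{\sqrt{2\pi a_i^2}}e^{-x_i^2/(2a_i^2)}\mathrm dx_i$ restricted to $P_I\ell^2$. $C_J=\{\sum_{i\in J}x_i\mathbf e_i\in P_J\ell^2:\sum_{i\in J}|\ln\frac1{\sqrt{2\pi a_i^2}}-\frac{x_i^2}{2a_i^2}|<\infty\}$; $F_J(\mathbf x_J)=\prod_{i\in J}\frac1{\sqrt{2\pi a_i^2}}e^{-x_i^2/(2a_i^2)}$ on $C_J$, $F_J=+\infty$ on $P_J\ell^2\setminus C_J$, $F_\emptyset\equiv1$. The surface measure $\mu_S$ is the unique Borel measure on $S$ with $\mu_S(E)=\int_{P_IE}n_I(\mathbf x_I+f(\mathbf x_I))F_{\mathbb N\setminus I}(f(\mathbf x_I))\,\mathrm d\mu_I(\mathbf x_I)$ for every local coordinate triple $(S\cap U,I,f)$ and Borel $E\subset S\cap U$. $S$ is $\sigma$-finite if $\mu_S$ is. A triple is bounded if $\sup_{\mathbf x_I\in U_I}n_I(\mathbf x_I+f(\mathbf x_I))F_{\mathbb N\setminus I}(f(\mathbf x_I))<\infty$. Orientation. $S$ with structure $\mathcal A$ is oriented if for all $(S\cap U_1,I_1,f_1),(S\cap U_2,I_2,f_2)\in\mathcal A$ and $\mathbf x\in S\cap U_1\cap U_2$: $\det(D(P_{I_2}P_{I_1}^{-1})(P_{I_1}\mathbf x))>0$ and $n_{I_1}(\mathbf x)=\bigl(\sum_{I'\in\Gamma_{I_0}}|\det(D(P_{I'}P_{I_1}^{-1})(P_{I_1}\mathbf x))|^2\bigr)^{1/2}<\infty$.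 Signed sequences. $S_{\mathbb N}$ is the set of nonempty finite or countably infinite sequences of pairwise distinct positive integers (indexed by $\{1,\dots,n\}$, $\{0,\dots,n\}$, $\mathbb N$ or $\mathbb N_0$). For $\mathbf I\in S_{\mathbb N}$, $|\mathbf I|$ is its set of entries and $\overline{\mathbf I}$ its increasing rearrangement. $S_{\mathbb N}^F$ is the set of $\mathbf I$ which can be brought to $\overline{\mathbf I}$ by finitely many transpositions of elements of $|\mathbf I|$ (applied entrywise); if $m$ transpositions do this, $s(\mathbf I)=(-1)^m$ (well defined). Regions with boundary. Let $S$ be as in the claim and $D\subset S$ be closed in $\ell^2$. A boundary datum at $\mathbf x\in D$ consists of: $\mathbf K=(k_0,k_1,\dots)\in S_{\mathbb N}^F$ with $s(\mathbf K)=1$, $|\mathbf K|\in\Gamma_{I_0}$; an index $i_0\in\mathbb N_0$ with $k_{i_0}\in|\mathbf K|$ such that $\mathbf K\setminus\{k_{i_0}\}:=(k_0,\dots,k_{i_0-1},k_{i_0+1},\dots)\in S_{\mathbb N}^F$; an open neighborhood $U$ of $\mathbf x$ in $\ell^2$; an open neighborhood $U_{|\mathbf K|}$ of $P_{|\mathbf K|}\mathbf x$ in $P_{|\mathbf K|}\ell^2$; an open neighborhood $V$ of $P_{|\mathbf K|\setminus\{k_{i_0}\}}\mathbf x$ in $P_{|\mathbf K|\setminus\{k_{i_0}\}}\ell^2$ with $P_{|\mathbf K|\setminus\{k_{i_0}\}}U_{|\mathbf K|}=V$; and continuously Fréchet differentiable maps $\Phi:V\to P_{\mathbb N\setminus|\mathbf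 K|}\ell^2$, $h:V\to\mathbb R$; such that $\mathbf x=\mathbf z+h(\mathbf z)\mathbf e_{k_{i_0}}+\Phi(\mathbf z)$ with $\mathbf z=P_{|\mathbf K|\setminus\{k_{i_0}\}}\mathbf x$, and $D\cap U=\{\mathbf y+\Phi(P_{|\mathbf K|\setminus\{k_{i_0}\}}\mathbf y):\mathbf y\in U_{|\mathbf K|},\rho(\mathbf y)\le0\}$, where $\rho(\mathbf y)=(-1)^{i_0-1}(\langle\mathbf y,\mathbf e_{k_{i_0}}\rangle-h(P_{|\mathbf K|\setminus\{k_{i_0}\}}\mathbf y))$. $\mathbf x\in D$ is an interior point if there is a local coordinate triple $(S\cap U,I,f)$ of $S$ with $\mathbf x\in S\cap U\subset D$, and a boundary point if it has a boundary datum. $D$ is a region with boundary in $S$ if each of its points is an interior or a boundary point; $D^\circ$, $\partial D$ denote the sets of interior and boundary points. Moreover the boundary data are required (and only such data are considered) to satisfy: (a) $(\partial D)\cap U=\{\mathbf y+h(\mathbf y)\mathbf e_{k_{i_0}}+\Phi(\mathbf y):\mathbf y\in V\}=\{\mathbf y+\Phi(P_{|\mathbf K|\setminus\{k_{i_0}\}}\mathbf y):\mathbf y\in U_{|\mathbf K|},\rho(\mathbf y)=0\}$ and $D^\circ\cap U=\{\mathbf y+\Phi(P_{|\mathbf K|\setminus\{k_{i_0}\}}\mathbf y):\mathbf y\in U_{|\mathbf K|},\rho(\mathbf y)<0\}$; (b) for every $\mathbf y\in(\partial D)\cap U$ there are reals $y^n$ with $\mathbf y^n:=y^n\mathbf e_{k_{i_0}}+P_{|\mathbf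 K|\setminus\{k_{i_0}\}}\mathbf y\in U_{|\mathbf K|}$, $\mathbf y_n:=\mathbf y^n+\Phi(P_{|\mathbf K|\setminus\{k_{i_0}\}}\mathbf y)\in D^\circ\cap U$ and $\mathbf y_n\to\mathbf y$; (c) $P_{|\mathbf K|\setminus\{k_{i_0}\}}$ restricts to a homeomorphism from $(\partial D)\cap U$ onto $V$. $\mathcal A_1$ is the collection of all triples $((\partial D)\cap U,\mathbf K\setminus\{k_{i_0}\},f)$ coming from boundary data, with $f(\mathbf y)=h(\mathbf y)\mathbf e_{k_{i_0}}+\Phi(\mathbf y)$, $\mathbf y\in V$; $|\mathcal A_1|$ is the collection of the corresponding $((\partial D)\cap U,|\mathbf K|\setminus\{k_{i_0}\},f)$; and $P_{|\mathbf K|\setminus\{k_{i_0}\}}^{-1}:V\to(\partial D)\cap U$ is $\mathbf y\mapsto\mathbf y+f(\mathbf y)$.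
   Formalization: Added: the coordinates |K| of boundary data must be positively oriented relative to the structure orienting S at interior points (automatic if that structure has all local coordinate triples; otherwise the claim can fail); ∂D is claimed to be a surface only if it is nonempty. *)

theory Defs
  imports "HOL-Probability.Probability" "Jordan_Normal_Form.Determinant"
begin

text \<open>
  The index set \<open>{1, 2, \<dots>}\<close> is represented by the type \<^typ>\<open>nat\<close>, through the order isomorphism
  \<open>k \<mapsto> k - 1\<close>: labels enter only through their order.  Index sets are values of type
  \<^typ>\<open>nat set\<close>, and the complement of \<open>I\<close> is \<open>- I\<close>.
\<close>

section \<open>The Hilbert space of square summable sequences\<close>

typedef ell2 = "{x :: nat \<Rightarrow> real. summable (\<lambda>i. (x i)\<^sup>2)}"
  by (rule exI[of _ "\<lambda>_. 0"]) simp

setup_lifting type_definition_ell2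

lemma ell2_prod_summable:
  fixes x y :: "nat \<Rightarrow> real"
  assumes "summable (\<lambda>i. (x i)\<^sup>2)" "summable (\<lambda>i. (y i)\<^sup>2)"
  shows "summable (\<lambda>i. x i * y i)"
proof (rule summable_comparison_test)
  show "summable (\<lambda>i. (x i)\<^sup>2 + (y i)\<^sup>2)"
    by (intro summable_add assms)
  have "\<bar>s * t\<bar> \<le> s\<^sup>2 + t\<^sup>2" for s t :: real
  proof -
    have "2 * (\<bar>s\<bar> * \<bar>t\<bar>) \<le> \<bar>s\<bar>\<^sup>2 + \<bar>t\<bar>\<^sup>2"
      using sum_squares_bound[of "\<bar>s\<bar>" "\<bar>t\<bar>"] by (simp add: mult.assoc)
    moreover have "0 \<le> \<bar>s\<bar> * \<bar>t\<bar>" by simp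
    ultimately show ?thesis unfolding abs_mult power2_abs by linarith
  qed
  then show "\<exists>N. \<forall>n\<ge>N. norm (x n * y n) \<le> (x n)\<^sup>2 + (y n)\<^sup>2"
    by auto
qed

lemma ell2_add_summable:
  fixes x y :: "nat \<Rightarrow> real"
  assumes "summable (\<lambda>i. (x i)\<^sup>2)" "summable (\<lambda>i. (y i)\<^sup>2)"
  shows "summable (\<lambda>i. (x i + y i)\<^sup>2)"
proof -
  have "summable (\<lambda>i. (x i)\<^sup>2 + (y i)\<^sup>2 + 2 * (x i * y i))"
    by (intro summable_add summable_mult assms ell2_prod_summable)
  then show ?thesis by (simp add: power2_sum mult.assoc)
qed

instantiation ell2 :: real_inner
begin

lift_definition zero_ell2 :: ell2 is "\<lambda>_. 0" by simp
lift_definition plus_ell2 :: "ell2 \<Rightarrow> ell2 \<Rightarrow> ell2" is "\<lambda>x y i. x i + y i"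
  by (rule ell2_add_summable)
lift_definition uminus_ell2 :: "ell2 \<Rightarrow> ell2" is "\<lambda>x i. - x i" by simp
lift_definition minus_ell2 :: "ell2 \<Rightarrow> ell2 \<Rightarrow> ell2" is "\<lambda>x y i. x i - y i"
  using ell2_add_summable[of _ "\<lambda>i. - _ i"] by simp
lift_definition scaleR_ell2 :: "real \<Rightarrow> ell2 \<Rightarrow> ell2" is "\<lambda>c x i. c * x i"
  by (simp add: power_mult_distrib summable_mult)
lift_definition inner_ell2 :: "ell2 \<Rightarrow> ell2 \<Rightarrow> real" is "\<lambda>x y. \<Sum>i. x i * y i" .

definition norm_ell2 :: "ell2 \<Rightarrow> real" where "norm_ell2 x = sqrt (inner x x)"
definition dist_ell2 :: "ell2 \<Rightarrow> ell2 \<Rightarrow> real" where "dist_ell2 x y = norm (x - y)"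
definition sgn_ell2 :: "ell2 \<Rightarrow> ell2" where "sgn_ell2 x = inverse (norm x) *\<^sub>R x"
definition uniformity_ell2 :: "(ell2 \<times> ell2) filter"
  where "uniformity_ell2 = (INF e\<in>{0<..}. principal {(x, y). dist x y < e})"
definition open_ell2 :: "ell2 set \<Rightarrow> bool"
  where "open_ell2 U = (\<forall>x\<in>U. eventually (\<lambda>(x', y). x' = x \<longrightarrow> y \<in> U) uniformity)"

instance
proof
  fix x y z :: ell2 and r s :: real and U :: "ell2 set"
  show "x + y + z = x + (y + z)" by transfer (simp add: add.assoc)
  show "x + y = y + x" by transfer (simp add: add.commute)
  show "0 + x = x" by transfer simp
  show "- x + x = 0" by transfer simp
  show "x - y = x + - y" by transfer simp
  show "r *\<^sub>R (x + y) = r *\<^sub>R x + r *\<^sub>R y" by transfer (simp add: algebra_simps)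
  show "(r + s) *\<^sub>R x = r *\<^sub>R x + s *\<^sub>R x" by transfer (simp add: algebra_simps)
  show "r *\<^sub>R s *\<^sub>R x = (r * s) *\<^sub>R x" by transfer (simp add: algebra_simps)
  show "1 *\<^sub>R x = x" by transfer simp
  show "inner x y = inner y x" by transfer (simp add: mult.commute)
  show "inner (x + y) z = inner x z + inner y z"
    by transfer (simp add: distrib_right suminf_add ell2_prod_summable)
  show "inner (r *\<^sub>R x) y = r * inner x y"
    by transfer (simp add: mult.assoc suminf_mult ell2_prod_summable)
  show "0 \<le> inner x x"
    by transfer (intro suminf_nonneg ell2_prod_summable; simp)
  show "inner x x = 0 \<longleftrightarrow> x = 0"
  proof (transfer, goal_cases)
    case (1 x)
    have "(\<Sum>i. (x i)\<^sup>2) = 0 \<longleftrightarrow> (\<forall>i. (x i)\<^sup>2 = 0)"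
      by (rule suminf_eq_zero_iff[OF 1]) simp
    then show ?case by (auto simp: power2_eq_square)
  qed
  show "norm x = sqrt (inner x x)" by (simp add: norm_ell2_def)
  show "dist x y = norm (x - y)" by (simp add: dist_ell2_def)
  show "sgn x = inverse (norm x) *\<^sub>R x" by (simp add: sgn_ell2_def)
  show "(uniformity :: (ell2 \<times> ell2) filter) = (INF e\<in>{0<..}. principal {(x, y). dist x y < e})"
    by (simp add: uniformity_ell2_def)
  show "open U = (\<forall>x\<in>U. \<forall>\<^sub>F (x', y) in uniformity. x' = x \<longrightarrow> y \<in> U)"
    by (simp add: open_ell2_def)
qed

end

lemma ell2_norm_sq: "(norm x)\<^sup>2 = (\<Sum>i. (Rep_ell2 x i)\<^sup>2)"
  unfolding power2_norm_eq_inner inner_ell2.rep_eq by (simp add: power2_eq_square)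

lemma ell2_sq_summable: "summable (\<lambda>i. (Rep_ell2 x i)\<^sup>2)"
  using Rep_ell2[of x] by simp

lemma ell2_sum_le_norm_sq: "(\<Sum>i<n. (Rep_ell2 x i)\<^sup>2) \<le> (norm x)\<^sup>2"
  unfolding ell2_norm_sq by (rule sum_le_suminf[OF ell2_sq_summable]) auto

lemma ell2_coord_le_norm: "\<bar>Rep_ell2 x i\<bar> \<le> norm x"
proof -
  have "(Rep_ell2 x i)\<^sup>2 \<le> (\<Sum>j<Suc i. (Rep_ell2 x j)\<^sup>2)"
    by (rule member_le_sum) auto
  also have "\<dots> \<le> (norm x)\<^sup>2" by (rule ell2_sum_le_norm_sq)
  finally show ?thesis using abs_le_square_iff[of "Rep_ell2 x i" "norm x"] by simp
qed

instance ell2 :: complete_space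
proof
  fix X :: "nat \<Rightarrow> ell2"
  assume X: "Cauchy X"
  have "Cauchy (\<lambda>n. Rep_ell2 (X n) i)" for i
  proof (rule metric_CauchyI)
    fix e :: real assume "0 < e"
    then obtain M where M: "\<And>m n. m \<ge> M \<Longrightarrow> n \<ge> M \<Longrightarrow> dist (X m) (X n) < e"
      using X by (meson metric_CauchyD)
    have "dist (Rep_ell2 (X m) i) (Rep_ell2 (X n) i) < e" if "m \<ge> M" "n \<ge> M" for m n
      using ell2_coord_le_norm[of "X m - X n" i] M[OF that]
      by (simp add: dist_norm minus_ell2.rep_eq)
    then show "\<exists>M. \<forall>m\<ge>M. \<forall>n\<ge>M. dist (Rep_ell2 (X m) i) (Rep_ell2 (X n) i) < e" by blast
  qed
  then have "\<exists>l. (\<lambda>n. Rep_ell2 (X n) i) \<longlonglongrightarrow> l" for i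
    by (simp add: Cauchy_convergent_iff convergent_def)
  then obtain l where l: "\<And>i. (\<lambda>n. Rep_ell2 (X n) i) \<longlonglongrightarrow> l i" by metis
  have key: "\<exists>M. \<forall>m\<ge>M. summable (\<lambda>i. (Rep_ell2 (X m) i - l i)\<^sup>2) \<and>
      (\<Sum>i. (Rep_ell2 (X m) i - l i)\<^sup>2) \<le> e\<^sup>2" if e: "0 < e" for e :: real
  proof -
    obtain M where M: "\<And>m n. m \<ge> M \<Longrightarrow> n \<ge> M \<Longrightarrow> dist (X m) (X n) < e"
      using X e by (meson metric_CauchyD)
    have "summable (\<lambda>i. (Rep_ell2 (X m) i - l i)\<^sup>2) \<and>
      (\<Sum>i. (Rep_ell2 (X m) i - l i)\<^sup>2) \<le> e\<^sup>2" if m: "m \<ge> M" for m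
    proof -
      have le: "(\<Sum>i<k. (Rep_ell2 (X m) i - l i)\<^sup>2) \<le> e\<^sup>2" for k
      proof (rule tendsto_upperbound)
        show "(\<lambda>n. \<Sum>i<k. (Rep_ell2 (X m) i - Rep_ell2 (X n) i)\<^sup>2)
            \<longlonglongrightarrow> (\<Sum>i<k. (Rep_ell2 (X m) i - l i)\<^sup>2)"
          by (intro tendsto_intros l)
        show "\<forall>\<^sub>F n in sequentially. (\<Sum>i<k. (Rep_ell2 (X m) i - Rep_ell2 (X n) i)\<^sup>2) \<le> e\<^sup>2"
        proof (rule eventually_sequentiallyI[of M])
          fix n assume n: "M \<le> n"
          have "(\<Sum>i<k. (Rep_ell2 (X m - X n) i)\<^sup>2) \<le> (norm (X m - X n))\<^sup>2"
            by (rule ell2_sum_le_norm_sq)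
          also have "\<dots> \<le> e\<^sup>2"
            using M[OF m n] by (intro power_mono) (auto simp: dist_norm)
          finally show "(\<Sum>i<k. (Rep_ell2 (X m) i - Rep_ell2 (X n) i)\<^sup>2) \<le> e\<^sup>2"
            by (simp add: minus_ell2.rep_eq)
        qed
      qed simp
      have "summable (\<lambda>i. (Rep_ell2 (X m) i - l i)\<^sup>2)"
        using le by (intro summableI_nonneg_bounded[where x = "e\<^sup>2"]) auto
      moreover from this le have "(\<Sum>i. (Rep_ell2 (X m) i - l i)\<^sup>2) \<le> e\<^sup>2"
        by (rule suminf_le_const)
      ultimately show ?thesis by simp
    qed
    then show ?thesis by blast
  qed
  obtain m where m: "summable (\<lambda>i. (Rep_ell2 (X m) i - l i)\<^sup>2)"
    using key[of 1] by auto
  have "summable (\<lambda>i. (Rep_ell2 (X m) i + - (Rep_ell2 (X m) i - l i))\<^sup>2)"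
    by (rule ell2_add_summable[OF ell2_sq_summable]) (simp only: power2_minus m)
  then have "summable (\<lambda>i. (l i)\<^sup>2)" by simp
  then have Rep: "Rep_ell2 (Abs_ell2 l) = l" by (simp add: Abs_ell2_inverse)
  have "X \<longlonglongrightarrow> Abs_ell2 l"
  proof (rule metric_LIMSEQ_I)
    fix e :: real assume "0 < e"
    then obtain M where M: "\<forall>m\<ge>M. (\<Sum>i. (Rep_ell2 (X m) i - l i)\<^sup>2) \<le> (e / 2)\<^sup>2"
      using key[of "e / 2"] by auto
    have "dist (X m) (Abs_ell2 l) < e" if "m \<ge> M" for m
    proof -
      have "(norm (X m - Abs_ell2 l))\<^sup>2 \<le> (e / 2)\<^sup>2"
        using M that by (simp add: ell2_norm_sq minus_ell2.rep_eq Rep)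
      then have "norm (X m - Abs_ell2 l) \<le> e / 2"
        by (rule power2_le_imp_le) (use \<open>0 < e\<close> in simp)
      then show ?thesis using \<open>0 < e\<close> by (simp add: dist_norm)
    qed
    then show "\<exists>M. \<forall>m\<ge>M. dist (X m) (Abs_ell2 l) < e" by blast
  qed
  then show "convergent X" by (auto simp: convergent_def)
qed

lift_definition basis_vec :: "nat \<Rightarrow> ell2" is "\<lambda>k i. if i = k then 1 else 0"
proof -
  fix k :: nat
  have "(\<lambda>i. (if i = k then 1 else 0 :: real)\<^sup>2) = (\<lambda>i. if i = k then 1 else 0)" by auto
  then show "summable (\<lambda>i. (if i = k then 1 else 0 :: real)\<^sup>2)" by simp
qed

lemma inner_basis_vec: "inner x (basis_vec k) = Rep_ell2 x k"
proof -
  have "(\<lambda>i. Rep_ell2 x i * (if i = k then 1 else 0)) = (\<lambda>i. if i = k then Rep_ell2 x i else 0)"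
    by auto
  moreover have "(\<Sum>i. if i = k then Rep_ell2 x i else 0) = Rep_ell2 x k"
    by (rule sums_unique[OF sums_single, symmetric])
  ultimately show ?thesis
    by (simp only: inner_ell2.rep_eq basis_vec.rep_eq)
qed

lift_definition proj :: "nat set \<Rightarrow> ell2 \<Rightarrow> ell2" is "\<lambda>I x i. if i \<in> I then x i else 0"
  by (rule summable_comparison_test) auto

text \<open>The next two lemmas identify \<^term>\<open>proj I\<close> as the orthogonal projection onto the closed
  span of the unit vectors with index in \<open>I\<close>.\<close>

lemma proj_in_closed_span: "proj I x \<in> closure (span (basis_vec ` I))"
proof -
  define p where "p n = (\<Sum>i<n. if i \<in> I then Rep_ell2 x i *\<^sub>R basis_vec i else 0)" for n
  have p_span: "p n \<in> span (basis_vec ` I)" for n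
    unfolding p_def by (intro span_sum) (auto intro: span_scale span_base span_zero)
  have Rep_p: "Rep_ell2 (p n) j = (if j < n \<and> j \<in> I then Rep_ell2 x j else 0)" for n j
    unfolding p_def
    by (induction n)
      (auto simp: zero_ell2.rep_eq plus_ell2.rep_eq scaleR_ell2.rep_eq basis_vec.rep_eq)
  have sq: "summable (\<lambda>i. (Rep_ell2 (proj I x) i)\<^sup>2)" by (rule ell2_sq_summable)
  have eq: "(norm (p n - proj I x))\<^sup>2 = (\<Sum>i. (Rep_ell2 (proj I x) (i + n))\<^sup>2)" for n
  proof -
    have "(norm (p n - proj I x))\<^sup>2 = (\<Sum>i. (Rep_ell2 (p n - proj I x) i)\<^sup>2)"
      by (rule ell2_norm_sq)
    also have "\<dots> = (\<Sum>i. (Rep_ell2 (p n - proj I x) (i + n))\<^sup>2)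
        + (\<Sum>i<n. (Rep_ell2 (p n - proj I x) i)\<^sup>2)"
      by (rule suminf_split_initial_segment[OF ell2_sq_summable])
    also have "(\<Sum>i<n. (Rep_ell2 (p n - proj I x) i)\<^sup>2) = 0"
      by (rule sum.neutral) (auto simp: minus_ell2.rep_eq Rep_p proj.rep_eq)
    also have "(\<lambda>i. (Rep_ell2 (p n - proj I x) (i + n))\<^sup>2) = (\<lambda>i. (Rep_ell2 (proj I x) (i + n))\<^sup>2)"
      by (auto simp: minus_ell2.rep_eq Rep_p)
    finally show ?thesis by simp
  qed
  have "(\<lambda>n. (norm (p n - proj I x))\<^sup>2) \<longlonglongrightarrow> 0"
    unfolding eq by (rule suminf_exist_split2[OF sq])
  then have "(\<lambda>n. norm (p n - proj I x)) \<longlonglongrightarrow> 0"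
    using tendsto_real_sqrt[of "\<lambda>n. (norm (p n - proj I x))\<^sup>2" 0 sequentially]
    by (simp only: real_sqrt_abs abs_norm_cancel real_sqrt_zero)
  then have "p \<longlonglongrightarrow> proj I x"
    by (simp add: tendsto_norm_zero_iff LIM_zero_iff)
  then show ?thesis
    unfolding closure_sequential using p_span by blast
qed

lemma proj_orthogonal:
  assumes "i \<in> I"
  shows "inner (x - proj I x) (basis_vec i) = 0"
  using assms by (simp add: inner_basis_vec minus_ell2.rep_eq proj.rep_eq)

abbreviation subsp :: "nat set \<Rightarrow> ell2 set" where "subsp I \<equiv> range (proj I)"

text \<open>Continuous Frechet differentiability on a relatively open subset \<open>V\<close> of \<open>subsp I\<close>.  Only the
  restriction of \<open>f' y\<close> to \<open>subsp I\<close> is determined by \<open>f\<close>; composing with \<^term>\<open>proj I\<close> shows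
  that taking \<open>f' y\<close> to be defined on the whole space is no restriction.\<close>

definition C1_on :: "nat set \<Rightarrow> ell2 set \<Rightarrow> (ell2 \<Rightarrow> 'b::real_normed_vector) \<Rightarrow> bool" where
  "C1_on I V f \<longleftrightarrow> openin (top_of_set (subsp I)) V \<and>
    (\<exists>f' :: ell2 \<Rightarrow> (ell2 \<Rightarrow>\<^sub>L 'b).
      (\<forall>y\<in>V. (f has_derivative blinfun_apply (f' y)) (at y within subsp I)) \<and> continuous_on V f')"

section \<open>Surfaces\<close>

definition sim :: "nat set \<Rightarrow> nat set \<Rightarrow> bool" where
  "sim I1 I2 \<longleftrightarrow> I1 \<noteq> {} \<and> I2 \<noteq> {} \<and>
    (\<exists>K1 K2. K1 \<subseteq> I1 \<and> K2 \<subseteq> - I1 \<and> finite K1 \<and> finite K2 \<and> card K1 = card K2 \<and>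
       I2 = (I1 - K1) \<union> K2)"

definition Gam :: "nat set \<Rightarrow> nat set set" where
  "Gam J = {I. sim I J}"

text \<open>A triple \<open>(W, I, f)\<close> stands for \<open>(S \<inter> U, I, f)\<close>; the domain of \<open>f\<close> is \<open>proj I ` W\<close>, and the values
  of the total function \<open>f\<close> elsewhere are irrelevant.  The parameter \<open>J\<close> is the set describing
  the codimension, so that the coordinate sets \<open>I\<close> range over \<open>Gam (- J)\<close>.\<close>

type_synonym triple = "ell2 set \<times> nat set \<times> (ell2 \<Rightarrow> ell2)"

definition local_triples :: "nat set \<Rightarrow> ell2 set \<Rightarrow> triple set" where
  "local_triples J S = {(W, I, f). W \<noteq> {} \<and> I \<in> Gam (- J) \<and>
     (\<exists>U UI. open U \<and> W = S \<inter> U \<and>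
        C1_on I UI f \<and> f ` UI \<subseteq> subsp (- I) \<and>
        (\<exists>g. homeomorphism W UI (proj I) g) \<and>
        W = {y + f y | y. y \<in> UI})}"

definition surface_codim :: "nat set \<Rightarrow> ell2 set \<Rightarrow> bool" where
  "surface_codim J S \<longleftrightarrow> - J \<noteq> {} \<and> S \<noteq> {} \<and>
     (\<forall>x\<in>S. \<exists>(W, I, f) \<in> local_triples J S. x \<in> W)"

definition C1_structure :: "nat set \<Rightarrow> ell2 set \<Rightarrow> triple set \<Rightarrow> bool" where
  "C1_structure J S A \<longleftrightarrow> A \<subseteq> local_triples J S \<and> (\<Union>(W, I, f)\<in>A. W) = S"

section \<open>Determinants\<close>

text \<open>\<open>minor_det M R C\<close> is the determinant of \<open>M\<close> with columns \<open>R\<close> and rows \<open>C\<close>, both in increasing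
  order; it is used for finite \<open>R\<close> and \<open>C\<close> of the same cardinality, and is 1 if both are empty.\<close>

definition minor_det :: "(nat \<Rightarrow> nat \<Rightarrow> real) \<Rightarrow> nat set \<Rightarrow> nat set \<Rightarrow> real" where
  "minor_det M R C = Determinant.det (Matrix.mat (card C) (card R)
     (\<lambda>(p, q). M (sorted_list_of_set R ! q) (sorted_list_of_set C ! p)))"

definition hat :: "nat set \<Rightarrow> nat set \<Rightarrow> nat set" where
  "hat I1 I2 = (if I1 = I2 then {}
     else {i \<in> I1 \<inter> I2. i \<le> Max ((I1 - I2) \<union> (I2 - I1))})"

definition op_det :: "nat set \<Rightarrow> nat set \<Rightarrow> (ell2 \<Rightarrow> ell2) \<Rightarrow> real" where
  "op_det I1 I2 T = minor_det (\<lambda>i j. inner (T (basis_vec i)) (basis_vec j))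
     ((I1 - I2) \<union> hat I1 I2) ((I2 - I1) \<union> hat I1 I2)"

text \<open>The map \<open>P\<^bsub>I'\<^esub> P\<^sub>I\<^sup>-\<^sup>1\<close> in the coordinates given by \<open>f\<close>, and the determinant of its derivative at
  \<open>P\<^sub>I x\<close>.  The derivative is taken within \<open>subsp I\<close>; it is unique on \<open>subsp I\<close>, and only its
  values on \<open>basis_vec i\<close> with \<open>i \<in> I\<close> enter the determinant.\<close>

definition transition :: "nat set \<Rightarrow> (ell2 \<Rightarrow> ell2) \<Rightarrow> ell2 \<Rightarrow> ell2" where
  "transition I' f y = proj I' (y + f y)"

definition transition_det :: "nat set \<Rightarrow> (ell2 \<Rightarrow> ell2) \<Rightarrow> nat set \<Rightarrow> ell2 \<Rightarrow> real" where
  "transition_det I f I' x =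
     op_det I I' (frechet_derivative (transition I' f) (at (proj I x) within subsp I))"

section \<open>Surface measure and boundedness\<close>

definition ennsqrt :: "ennreal \<Rightarrow> ennreal" where
  "ennsqrt t = (if t = \<infinity> then \<infinity> else ennreal (sqrt (enn2real t)))"

definition partial_deriv :: "(ell2 \<Rightarrow> ell2) \<Rightarrow> ell2 \<Rightarrow> nat \<Rightarrow> nat \<Rightarrow> real" where
  "partial_deriv f y i j = deriv (\<lambda>t. inner (f (y + t *\<^sub>R basis_vec i)) (basis_vec j)) 0"

text \<open>\<open>n_fac I f y\<close> is \<open>n\<^sub>I\<close> at the point \<open>y + f y\<close>.\<close>

definition n_fac :: "nat set \<Rightarrow> (ell2 \<Rightarrow> ell2) \<Rightarrow> ell2 \<Rightarrow> ennreal" where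
  "n_fac I f y = ennsqrt (1 +
     (\<Sum>\<^sub>\<infinity>(K1, K2)\<in>{(K1, K2). K1 \<subseteq> I \<and> K2 \<subseteq> - I \<and> finite K1 \<and> finite K2 \<and>
         card K1 = card K2 \<and> card K1 \<ge> 1}.
       ennreal (\<bar>minor_det (partial_deriv f y) K1 K2\<bar>\<^sup>2)))"

definition zero_ext :: "nat set \<Rightarrow> (nat \<Rightarrow> real) \<Rightarrow> nat \<Rightarrow> real" where
  "zero_ext I x = (\<lambda>i. if i \<in> I then x i else 0)"

definition gauss :: "(nat \<Rightarrow> real) \<Rightarrow> nat set \<Rightarrow> ell2 measure" where
  "gauss a I = distr
     (restrict_space (\<Pi>\<^sub>M i\<in>I. density lborel (\<lambda>t. ennreal (normal_density 0 (a i) t)))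
        {x. summable (\<lambda>i. (zero_ext I x i)\<^sup>2)})
     borel (\<lambda>x. Abs_ell2 (zero_ext I x))"

definition C_set :: "(nat \<Rightarrow> real) \<Rightarrow> nat set \<Rightarrow> ell2 set" where
  "C_set a J = {x \<in> subsp J.
     (\<lambda>i. \<bar>ln (1 / sqrt (2 * pi * (a i)\<^sup>2)) - (inner x (basis_vec i))\<^sup>2 / (2 * (a i)\<^sup>2)\<bar>) summable_on J}"

definition F_fac :: "(nat \<Rightarrow> real) \<Rightarrow> nat set \<Rightarrow> ell2 \<Rightarrow> ennreal" where
  "F_fac a J x = (if x \<in> C_set a J
     then ennreal (\<Prod>i. if i \<in> J then normal_density 0 (a i) (inner x (basis_vec i)) else 1)
     else \<infinity>)"

definition surface_measure :: "(nat \<Rightarrow> real) \<Rightarrow> nat set \<Rightarrow> ell2 set \<Rightarrow> ell2 measure" where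
  "surface_measure a J S = (THE M. sets M = sets (restrict_space borel S) \<and>
     (\<forall>(W, I, f) \<in> local_triples J S. \<forall>E \<in> sets M. E \<subseteq> W \<longrightarrow>
        emeasure M E = (\<integral>\<^sup>+ y \<in> proj I ` E. (n_fac I f y * F_fac a (- I) (f y)) \<partial>gauss a I)))"

definition bounded_triple :: "(nat \<Rightarrow> real) \<Rightarrow> triple \<Rightarrow> bool" where
  "bounded_triple a = (\<lambda>(W, I, f). (SUP y \<in> proj I ` W. n_fac I f y * F_fac a (- I) (f y)) < \<infinity>)"

definition oriented :: "nat set \<Rightarrow> triple set \<Rightarrow> bool" where
  "oriented I0 A \<longleftrightarrow> (\<forall>(W1, I1, f1) \<in> A. \<forall>(W2, I2, f2) \<in> A. \<forall>x \<in> W1 \<inter> W2.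
     transition_det I1 f1 I2 x > 0 \<and>
     n_fac I1 f1 (proj I1 x) =
       ennsqrt (\<Sum>\<^sub>\<infinity>I' \<in> Gam I0. ennreal (\<bar>transition_det I1 f1 I' x\<bar>\<^sup>2)) \<and>
     n_fac I1 f1 (proj I1 x) < \<infinity>)"

section \<open>Signed sequences\<close>

text \<open>A finite or infinite sequence is a partial function whose domain is an initial segment of
  \<^typ>\<open>nat\<close>; its set of entries is \<open>ran K\<close>.  All sequences are indexed from 0.\<close>

type_synonym iseq = "nat \<Rightarrow> nat option"

definition is_seq :: "iseq \<Rightarrow> bool" where
  "is_seq K \<longleftrightarrow> dom K \<noteq> {} \<and> (\<forall>j \<in> dom K. \<forall>i < j. i \<in> dom K) \<and> inj_on K (dom K)"

definition increasing :: "nat set \<Rightarrow> iseq" where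
  "increasing A = (\<lambda>n. if infinite A \<or> n < card A then Some (enumerate A n) else None)"

inductive transp_steps :: "nat \<Rightarrow> iseq \<Rightarrow> iseq \<Rightarrow> bool" where
  "transp_steps 0 K K"
| "transp_steps m K L \<Longrightarrow> b \<in> ran K \<Longrightarrow> c \<in> ran K \<Longrightarrow> b \<noteq> c \<Longrightarrow>
     transp_steps (Suc m) K (\<lambda>i. map_option (Transposition.transpose b c) (L i))"

definition SF :: "iseq set" where
  "SF = {K. is_seq K \<and> (\<exists>m. transp_steps m K (increasing (ran K)))}"

definition seq_sign :: "iseq \<Rightarrow> real" where
  "seq_sign K = (THE \<epsilon>. \<exists>m. transp_steps m K (increasing (ran K)) \<and> \<epsilon> = (-1) ^ m)"

definition seq_del :: "iseq \<Rightarrow> nat \<Rightarrow> iseq" where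
  "seq_del K i = (\<lambda>j. if j < i then K j else K (Suc j))"

section \<open>Regions with boundary\<close>

record bdatum =
  dK :: iseq
  dpos :: nat
  dU :: "ell2 set"
  dUK :: "ell2 set"
  dV :: "ell2 set"
  dPhi :: "ell2 \<Rightarrow> ell2"
  dh :: "ell2 \<Rightarrow> real"

definition dset :: "bdatum \<Rightarrow> nat set" where "dset d = ran (dK d)"
definition dk :: "bdatum \<Rightarrow> nat" where "dk d = the (dK d (dpos d))"
definition dred :: "bdatum \<Rightarrow> nat set" where "dred d = dset d - {dk d}"

definition rho :: "bdatum \<Rightarrow> ell2 \<Rightarrow> real" where
  "rho d y = (-1) powi (int (dpos d) - 1) * (inner y (basis_vec (dk d)) - dh d (proj (dred d) y))"

text \<open>The data before the requirements (a), (b), (c), which refer to the sets of interior and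
  boundary points, are imposed.\<close>

definition is_bdatum :: "nat set \<Rightarrow> ell2 set \<Rightarrow> ell2 \<Rightarrow> bdatum \<Rightarrow> bool" where
  "is_bdatum I0 D x d \<longleftrightarrow>
     dK d \<in> SF \<and> seq_sign (dK d) = 1 \<and> dset d \<in> Gam I0 \<and>
     dpos d \<in> dom (dK d) \<and> seq_del (dK d) (dpos d) \<in> SF \<and>
     open (dU d) \<and> x \<in> dU d \<and>
     openin (top_of_set (subsp (dset d))) (dUK d) \<and> proj (dset d) x \<in> dUK d \<and>
     openin (top_of_set (subsp (dred d))) (dV d) \<and> proj (dred d) x \<in> dV d \<and>
     proj (dred d) ` dUK d = dV d \<and>
     C1_on (dred d) (dV d) (dPhi d) \<and> dPhi d ` dV d \<subseteq> subsp (- dset d) \<and>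
     C1_on (dred d) (dV d) (dh d) \<and>
     x = proj (dred d) x + dh d (proj (dred d) x) *\<^sub>R basis_vec (dk d) + dPhi d (proj (dred d) x) \<and>
     D \<inter> dU d = {y + dPhi d (proj (dred d) y) | y. y \<in> dUK d \<and> rho d y \<le> 0}"

definition interior_pts :: "nat set \<Rightarrow> ell2 set \<Rightarrow> ell2 set \<Rightarrow> ell2 set" where
  "interior_pts I0 S D = {x \<in> D. \<exists>(W, I, f) \<in> local_triples (- I0) S. x \<in> W \<and> W \<subseteq> D}"

definition boundary_pts :: "nat set \<Rightarrow> ell2 set \<Rightarrow> ell2 set" where
  "boundary_pts I0 D = {x \<in> D. \<exists>d. is_bdatum I0 D x d}"

definition admissible :: "nat set \<Rightarrow> ell2 set \<Rightarrow> ell2 set \<Rightarrow> ell2 \<Rightarrow> bdatum \<Rightarrow> bool" where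
  "admissible I0 S D x d \<longleftrightarrow> x \<in> D \<and> is_bdatum I0 D x d \<and>
     (let B = boundary_pts I0 D; R = interior_pts I0 S D; P = proj (dred d); e = basis_vec (dk d)
      in
        \<comment> \<open>(a)\<close>
        B \<inter> dU d = {y + dh d y *\<^sub>R e + dPhi d y | y. y \<in> dV d} \<and>
        B \<inter> dU d = {y + dPhi d (P y) | y. y \<in> dUK d \<and> rho d y = 0} \<and>
        R \<inter> dU d = {y + dPhi d (P y) | y. y \<in> dUK d \<and> rho d y < 0} \<and>
        \<comment> \<open>(b)\<close>
        (\<forall>y \<in> B \<inter> dU d. \<exists>t :: nat \<Rightarrow> real.
           (\<forall>n. t n *\<^sub>R e + P y \<in> dUK d \<and> t n *\<^sub>R e + P y + dPhi d (P y) \<in> R \<inter> dU d) \<and>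
           (\<lambda>n. t n *\<^sub>R e + P y + dPhi d (P y)) \<longlonglongrightarrow> y) \<and>
        \<comment> \<open>(c)\<close>
        (\<exists>g. homeomorphism (B \<inter> dU d) (dV d) P g))"

definition region_with_boundary :: "nat set \<Rightarrow> ell2 set \<Rightarrow> ell2 set \<Rightarrow> bool" where
  "region_with_boundary I0 S D \<longleftrightarrow> D \<subseteq> S \<and> closed D \<and>
     D = interior_pts I0 S D \<union> boundary_pts I0 D \<and>
     (\<forall>x \<in> boundary_pts I0 D. \<exists>d. admissible I0 S D x d)"

definition A1 :: "nat set \<Rightarrow> ell2 set \<Rightarrow> ell2 set \<Rightarrow> (ell2 set \<times> iseq \<times> (ell2 \<Rightarrow> ell2)) set" where
  "A1 I0 S D = {(boundary_pts I0 D \<inter> dU d, seq_del (dK d) (dpos d),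
       \<lambda>y. dh d y *\<^sub>R basis_vec (dk d) + dPhi d y) | d x. admissible I0 S D x d}"

definition abs_A1 :: "nat set \<Rightarrow> ell2 set \<Rightarrow> ell2 set \<Rightarrow> triple set" where
  "abs_A1 I0 S D = (\<lambda>(W, K, f). (W, ran K, f)) ` A1 I0 S D"

text \<open>The coordinates \<open>|K|\<close> used by a boundary datum agree with the orientation given by \<open>A\<close>.
  The condition is automatic if \<open>A\<close> is the family of all local coordinate triples of \<open>S\<close>.  For
  a smaller family it has to be imposed: on the surface \<open>x\<^sub>3 = - x\<^sub>2\<close> (all coordinates of index
  above 3 being constant), the coordinates (1, 2) and (1, 3) are both available but have
  opposite orientations; yet both give boundary data for the region \<open>x\<^sub>1 \<ge> 0\<close>.\<close>

definition data_oriented :: "nat set \<Rightarrow> ell2 set \<Rightarrow> triple set \<Rightarrow> ell2 set \<Rightarrow> bool" where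
  "data_oriented I0 S A D \<longleftrightarrow> (\<forall>x d. admissible I0 S D x d \<longrightarrow>
     (\<forall>(W, I, f) \<in> A. \<forall>y \<in> W \<inter> interior_pts I0 S D \<inter> dU d. transition_det I f (dset d) y > 0))"

end

theory Submission
  imports Defs
begin

text \<open>Every patch of a surface is a graph over a coordinate subspace, so \<open>r z = P\<^sub>I z + f (P\<^sub>I z)\<close> is a
  map of the whole space near the patch which retracts it onto the patch (\<open>graph_map\<close>).  Its
  derivative at a point of the patch is the projection onto the tangent space along the kernel of
  \<open>P\<^sub>I\<close> (\<open>tangent_proj\<close>), and the derivative of a coordinate change \<open>P\<^sub>J P\<^sub>I\<^sup>-\<^sup>1\<close> is \<open>P\<^sub>J\<close> after this
  projection (\<open>transition_graph_map\<close>).  If one retraction fixes the image of another, differentiating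
  that identity gives the same relation between the tangent projections
  (\<open>retraction_derivative_fixes\<close>).  All comparisons of patches reduce to such relations, and
  the determinants are multiplicative for them (\<open>op_det_tangent_compose\<close>).

  A boundary datum over the index set \<open>K\<close> with distinguished element \<open>k\<close> provides two retractions:
  \<open>edge_map\<close>, onto the boundary, with coordinates in \<open>K - {k}\<close>; and \<open>collar_map\<close>, with coordinates in
  \<open>K\<close>, onto a graph that contains the region near the boundary point but runs beyond its edge.  Let two
  data with \<open>K, k, i\<^sub>0\<close> and \<open>K', k', i\<^sub>1\<close> meet at a boundary point \<open>x\<close>.  The sign of the boundary
  determinant \<open>m\<close> is found in four steps.

  \<^item> The collar transition has a positive determinant \<open>\<delta>\<close> at \<open>x\<close>.  At nearby interior points both
    collars are coordinates on \<open>S\<close> that agree with its orientation, so that \<open>\<delta> > 0\<close>, and the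
    transition in the opposite direction has determinant \<open>1 / \<delta>\<close> (\<open>collar_det_interior\<close>).  Both
    determinants are continuous up to \<open>x\<close>, hence \<open>\<delta> \<ge> 0\<close> and \<open>\<delta> \<noteq> 0\<close> there.

  \<^item> The collar transition maps the tangent space of the boundary to itself, by the boundary
    transition, and it multiplies the transversal direction by a number \<open>c\<close>.  Expanding the
    determinant along that direction gives \<open>\<delta> = (-1)\<^bsup>p + q\<^esup> c m\<close>, where \<open>p\<close> and \<open>q\<close> are the
    numbers of elements of \<open>K\<close> below \<open>k\<close> and of \<open>K'\<close> below \<open>k'\<close> (\<open>op_det_hypersurface\<close>).

  \<^item> Moving along \<open>e\<^sub>k\<close> into the interior changes both defining functions \<open>\<rho>\<close> in the negative sense;
    as these carry the signs \<open>(-1)\<close> to the powers \<open>i\<^sub>0 - 1\<close> and \<open>i\<^sub>1 - 1\<close>, the number \<open>c\<close> has the sign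
    of \<open>(-1)\<^bsup>i\<^sub>0 + i\<^sub>1\<^esup>\<close>.

  \<^item> Deleting the entry with index \<open>i\<^sub>0\<close> multiplies the sign of a sequence by \<open>(-1)\<^bsup>i\<^sub>0 + p\<^esup>\<close>
    (\<open>seq_sign_seq_del\<close>).

  So the product of the two signs is \<open>(-1)\<^bsup>i\<^sub>0 + i\<^sub>1 + p + q\<^esup>\<close>, which is the sign of \<open>m\<close>.\<close>

section \<open>Signs of sequences\<close>

text \<open>The composite of any transpositions that sort \<open>K\<close>.  Fixing the numbers outside \<open>K\<close> makes it unique.\<close>

definition sorts :: "(nat \<Rightarrow> nat) \<Rightarrow> iseq \<Rightarrow> bool" where
  "sorts \<pi> K \<longleftrightarrow> permutation \<pi> \<and> (\<forall>x. x \<notin> ran K \<longrightarrow> \<pi> x = x) \<and>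
     (\<forall>i. map_option \<pi> (K i) = increasing (ran K) i)"

lemma transp_steps_permutation:
  assumes "transp_steps m K L"
  shows "\<exists>\<pi>. permutation \<pi> \<and> (\<forall>x. x \<notin> ran K \<longrightarrow> \<pi> x = x) \<and>
    (\<forall>i. map_option \<pi> (K i) = L i) \<and> sign \<pi> = (-1) ^ m"
  using assms
proof induction
  case (1 K)
  show ?case by (intro exI[of _ id]) (auto simp: id_def option.map_ident)
next
  case (2 m K L b c)
  then obtain \<pi> where \<pi>: "permutation \<pi>" "\<And>x. x \<notin> ran K \<Longrightarrow> \<pi> x = x"
    "\<And>i. map_option \<pi> (K i) = L i" "sign \<pi> = (-1) ^ m" by blast
  let ?t = "Transposition.transpose b c"
  have "permutation (?t \<circ> \<pi>)" by (intro permutation_compose permutation_swap_id \<pi>)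
  moreover have "sign (?t \<circ> \<pi>) = (-1) ^ Suc m"
    using 2 \<pi> by (simp add: sign_compose permutation_swap_id sign_swap_id)
  moreover have "(?t \<circ> \<pi>) x = x" if "x \<notin> ran K" for x
    using that 2 \<pi>(2) by (auto simp: Transposition.transpose_def)
  moreover have "map_option (?t \<circ> \<pi>) (K i) = map_option ?t (L i)" for i
    by (simp flip: \<pi>(3) add: option.map_comp)
  ultimately show ?case by blast
qed

lemma sorts_unique:
  assumes "sorts \<pi> K" "sorts \<pi>' K"
  shows "\<pi> = \<pi>'"
proof
  fix x
  show "\<pi> x = \<pi>' x"
  proof (cases "x \<in> ran K")
    case True
    then obtain i where i: "K i = Some x" by (auto simp: ran_def)
    have "map_option \<pi> (K i) = map_option \<pi>' (K i)"
      using assms by (simp add: sorts_def)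
    then show ?thesis by (simp add: i)
  qed (use assms in \<open>simp add: sorts_def\<close>)
qed

text \<open>The parity of the number of transpositions is well defined because any two ways of sorting \<open>K\<close>
  compose to the same permutation.\<close>

lemma seq_sign_sorts:
  assumes "K \<in> SF"
  obtains \<pi> where "sorts \<pi> K" "seq_sign K = of_int (sign \<pi>)"
proof -
  obtain m where m: "transp_steps m K (increasing (ran K))"
    using assms by (auto simp: SF_def)
  have ex: "\<exists>\<pi>. sorts \<pi> K \<and> sign \<pi> = (-1) ^ n"
    if "transp_steps n K (increasing (ran K))" for n
    using transp_steps_permutation[OF that] unfolding sorts_def by blast
  from ex[OF m] obtain \<pi> where \<pi>: "sorts \<pi> K" "sign \<pi> = (-1) ^ m" by blast
  have "seq_sign K = (-1) ^ m"
    unfolding seq_sign_def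
  proof (rule the_equality)
    show "\<exists>ma. transp_steps ma K (increasing (ran K)) \<and> (-1) ^ m = (-1 :: real) ^ ma"
      using m by blast
    fix \<epsilon> :: real
    assume "\<exists>m. transp_steps m K (increasing (ran K)) \<and> \<epsilon> = (-1) ^ m"
    then obtain n where n: "transp_steps n K (increasing (ran K))" "\<epsilon> = (-1) ^ n" by blast
    from ex[OF n(1)] obtain \<pi>' where \<pi>': "sorts \<pi>' K" "sign \<pi>' = (-1) ^ n" by blast
    have "\<pi>' = \<pi>" by (rule sorts_unique[OF \<pi>'(1) \<pi>(1)])
    then have "(-1 :: int) ^ n = (-1) ^ m" using \<pi> \<pi>' by simp
    then have "real_of_int ((-1) ^ n) = real_of_int ((-1) ^ m)" by (rule arg_cong)
    then show "\<epsilon> = (-1) ^ m" by (simp add: n)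
  qed
  then show thesis using that[OF \<pi>(1)] \<pi>(2) by simp
qed

text \<open>Positions in the increasing enumeration are numbers of smaller elements.  In this form finite and
  infinite sets are treated alike.\<close>

lemma increasing_eq_Some_iff:
  "increasing A n = Some x \<longleftrightarrow> x \<in> A \<and> card (A \<inter> {..<x}) = n"
proof -
  let ?v = "\<lambda>n. infinite A \<or> n < card A"
  have mem: "enumerate A n \<in> A" if "?v n" for n
    using that by (cases "finite A") (auto intro: enumerate_in_set finite_enumerate_in_set)
  have mono: "enumerate A m < enumerate A n" if "m < n" "?v n" for m n
    using that by (cases "finite A") (auto intro: enumerate_mono finite_enumerate_mono)
  have surj: "\<exists>m. ?v m \<and> enumerate A m = y" if "y \<in> A" for y
    using that by (cases "finite A") (auto dest: enumerate_Ex finite_enumerate_Ex)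
  have card: "card (A \<inter> {..<enumerate A n}) = n" if v: "?v n" for n
  proof -
    have "A \<inter> {..<enumerate A n} = enumerate A ` {..<n}"
    proof (intro equalityI subsetI)
      fix y assume y: "y \<in> A \<inter> {..<enumerate A n}"
      then obtain m where m: "?v m" "enumerate A m = y" using surj by auto
      then have "m < n" using y mono[of n m] by (cases m n rule: linorder_cases) auto
      then show "y \<in> enumerate A ` {..<n}" using m by auto
    qed (use v in \<open>auto intro: mem mono\<close>)
    moreover have "inj_on (enumerate A) {..<n}"
      by (rule linorder_inj_onI') (use v mono in force)
    ultimately show ?thesis by (simp add: card_image)
  qed
  show ?thesis
  proof
    assume "increasing A n = Some x"
    then have "?v n" "x = enumerate A n" by (auto simp: increasing_def split: if_splits)
    then show "x \<in> A \<and> card (A \<inter> {..<x}) = n" using mem card by simp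
  next
    assume *: "x \<in> A \<and> card (A \<inter> {..<x}) = n"
    then obtain m where m: "?v m" "enumerate A m = x" using surj by blast
    then have "m = n" using card[of m] * by simp
    then show "increasing A n = Some x" using m by (simp add: increasing_def)
  qed
qed

definition seq_ins :: "nat \<Rightarrow> nat \<Rightarrow> iseq \<Rightarrow> iseq" where
  "seq_ins k i L = (\<lambda>j. if j < i then L j else if j = i then Some k else L (j - 1))"

lemma seq_ins_del: "K i = Some k \<Longrightarrow> seq_ins k i (seq_del K i) = K"
  by (auto simp: seq_ins_def seq_del_def fun_eq_iff)

lemma ran_seq_ins:
  "ran (seq_ins k i L) = insert k (ran L)"
proof (intro equalityI subsetI)
  fix x assume "x \<in> ran (seq_ins k i L)"
  then obtain j where "seq_ins k i L j = Some x" by (auto simp: ran_def)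
  then show "x \<in> insert k (ran L)"
    by (auto simp: seq_ins_def split: if_splits intro: ranI)
next
  fix x assume "x \<in> insert k (ran L)"
  then consider "x = k" | j where "L j = Some x" by (auto simp: ran_def)
  then show "x \<in> ran (seq_ins k i L)"
  proof cases
    case 1
    then have "seq_ins k i L i = Some x" by (simp add: seq_ins_def)
    then show ?thesis by (rule ranI)
  next
    case (2 j)
    then have "seq_ins k i L (if j < i then j else Suc j) = Some x" by (simp add: seq_ins_def)
    then show ?thesis by (rule ranI)
  qed
qed

text \<open>Moving \<open>k\<close> one place to the right exchanges it with its neighbour, that is, applies one transposition
  of entries; \<open>i\<close> of these bring it from the front to position \<open>i\<close>.\<close>

lemma seq_ins_move_front:
  assumes "\<And>j. j < i \<Longrightarrow> L j \<noteq> None" and inj: "inj_on L (dom L)" and k: "k \<notin> ran L"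
  shows "\<exists>\<rho>. permutation \<rho> \<and> (\<forall>x. x \<notin> insert k (ran L) \<longrightarrow> \<rho> x = x) \<and> sign \<rho> = (-1) ^ i \<and>
    (\<forall>j. map_option \<rho> (seq_ins k 0 L j) = seq_ins k i L j)"
  using assms(1)
proof (induction i)
  case 0
  show ?case by (intro exI[of _ id]) (auto simp: id_def option.map_ident)
next
  case (Suc i)
  then obtain \<rho> where \<rho>: "permutation \<rho>" "\<And>x. x \<notin> insert k (ran L) \<Longrightarrow> \<rho> x = x" "sign \<rho> = (-1) ^ i"
    "\<And>j. map_option \<rho> (seq_ins k 0 L j) = seq_ins k i L j" by force
  obtain l where l: "L i = Some l" using Suc.prems[of i] by auto
  have lr: "l \<in> ran L" using l by (auto simp: ran_def)
  with k have "l \<noteq> k" by auto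
  have other: "L j \<noteq> Some l" if "j \<noteq> i" for j
    using inj l that by (metis domI inj_onD)
  have other': "L j \<noteq> Some k" for j using k by (auto simp: ran_def)
  let ?t = "Transposition.transpose k l"
  have fixed: "map_option ?t (L j) = L j" if "j \<noteq> i" for j
    using other[OF that] other'[of j] by (cases "L j") (auto simp: Transposition.transpose_def)
  have "map_option ?t (seq_ins k i L j) = seq_ins k (Suc i) L j" for j
  proof -
    consider "j < i" | "j = i" | "j = Suc i" | "j > Suc i" by linarith
    then show ?thesis
      by cases (auto simp: seq_ins_def l fixed)
  qed
  then have "\<forall>j. map_option (?t \<circ> \<rho>) (seq_ins k 0 L j) = seq_ins k (Suc i) L j"
    by (simp flip: \<rho>(4) add: option.map_comp)
  moreover have "permutation (?t \<circ> \<rho>)" by (intro permutation_compose permutation_swap_id \<rho>)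
  moreover have "sign (?t \<circ> \<rho>) = (-1) ^ Suc i"
    using \<open>l \<noteq> k\<close> \<rho> by (simp add: sign_compose permutation_swap_id sign_swap_id)
  moreover have "(?t \<circ> \<rho>) x = x" if "x \<notin> insert k (ran L)" for x
    using that lr \<rho>(2) by (auto simp: Transposition.transpose_def)
  ultimately show ?case by blast
qed

lemma increasing_insert:
  assumes "k \<in> A"
  shows "seq_ins k (card (A \<inter> {..<k})) (increasing (A - {k})) = increasing A"
proof -
  let ?p = "card (A \<inter> {..<k})"
  have below: "(A - {k}) \<inter> {..<x} = A \<inter> {..<x}" if "x \<le> k" for x using that by auto
  have below_card: "card (A \<inter> {..<x}) < ?p" if "x < k" "x \<in> A" for x
    by (rule psubset_card_mono) (use that in auto)
  have above: "card (A \<inter> {..<x}) = Suc (card ((A - {k}) \<inter> {..<x}))" if "x > k" for x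
  proof -
    have "A \<inter> {..<x} = insert k ((A - {k}) \<inter> {..<x})" using that assms by auto
    then show ?thesis by (simp add: card_insert_if)
  qed
  have above_card: "?p \<le> card ((A - {k}) \<inter> {..<x})" if "x > k" for x
    by (rule card_mono) (use that in auto)
  have "seq_ins k ?p (increasing (A - {k})) n = Some x \<longleftrightarrow> increasing A n = Some x" for n x
  proof -
    consider "x < k" | "x = k" | "x > k" by linarith
    then show ?thesis
    proof cases
      case 1
      then have "card ((A - {k}) \<inter> {..<x}) = card (A \<inter> {..<x})" "x \<noteq> k"
        using below[of x] by simp_all
      then show ?thesis
        using below_card[OF 1] unfolding seq_ins_def by (simp add: increasing_eq_Some_iff) linarith
    next
      case 2
      then show ?thesis using assms unfolding seq_ins_def by (auto simp: increasing_eq_Some_iff)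
    next
      case 3
      then show ?thesis
        using above[OF 3] above_card[OF 3] unfolding seq_ins_def
        by (simp add: increasing_eq_Some_iff) linarith
    qed
  qed
  then have "seq_ins k ?p (increasing (A - {k})) n = increasing A n" for n
    by (metis not_None_eq)
  then show ?thesis by (rule ext)
qed

text \<open>Both \<open>K\<close> and the increasing enumeration of its entries arise from the shortened sequences by
  inserting \<open>k\<close>, the former at position \<open>i\<close> and the latter at the position given by the number of
  entries below \<open>k\<close>.  Moving \<open>k\<close> to the front in both accounts for the exponent.\<close>

lemma seq_sign_seq_del:
  assumes "K \<in> SF" and k: "K i = Some k" and "seq_del K i \<in> SF"
  shows "ran (seq_del K i) = ran K - {k}"
    and "seq_sign (seq_del K i) = seq_sign K * (-1) ^ (i + card (ran K \<inter> {..<k}))"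
proof -
  let ?L = "seq_del K i" and ?p = "card (ran K \<inter> {..<k})"
  have inj: "inj_on K (dom K)" and init: "\<And>j. j < i \<Longrightarrow> K j \<noteq> None"
    using assms(1) k by (auto simp: SF_def is_seq_def dom_def)
  have injL: "inj_on ?L (dom ?L)"
    using assms(3) by (simp add: SF_def is_seq_def)
  have ins: "seq_ins k i ?L = K" by (rule seq_ins_del[of K i k, OF k])
  have uniq: "K j \<noteq> Some k" if "j \<noteq> i" for j
    using inj k that by (metis domI inj_onD)
  then have kL: "k \<notin> ran ?L" by (auto simp: ran_def seq_del_def)
  have ranK: "ran K = insert k (ran ?L)" using ran_seq_ins[of k i ?L] by (simp add: ins)
  with kL show ranL: "ran ?L = ran K - {k}" by auto
  have kK: "k \<in> ran K" using ranK by simp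
  obtain \<pi> where \<pi>: "sorts \<pi> K" "seq_sign K = of_int (sign \<pi>)"
    by (rule seq_sign_sorts[OF assms(1)])
  obtain \<sigma> where \<sigma>: "sorts \<sigma> ?L" "seq_sign ?L = of_int (sign \<sigma>)"
    by (rule seq_sign_sorts[OF assms(3)])
  have "\<exists>\<rho>. permutation \<rho> \<and> (\<forall>x. x \<notin> insert k (ran ?L) \<longrightarrow> \<rho> x = x) \<and> sign \<rho> = (-1) ^ i \<and>
    (\<forall>j. map_option \<rho> (seq_ins k 0 ?L j) = seq_ins k i ?L j)"
    by (rule seq_ins_move_front[OF _ injL kL]) (use init in \<open>auto simp: seq_del_def\<close>)
  then obtain \<rho> where \<rho>: "permutation \<rho>" "\<And>x. x \<notin> ran K \<Longrightarrow> \<rho> x = x" "sign \<rho> = (-1) ^ i"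
    "\<And>j. map_option \<rho> (seq_ins k 0 ?L j) = K j" unfolding ins ranK by blast
  have L_def: "?L j \<noteq> None" if "j < ?p" for j
  proof -
    have "seq_ins k ?p (increasing (ran ?L)) j = increasing (ran K) j"
      unfolding ranL by (simp add: increasing_insert[OF kK])
    then have "increasing (ran ?L) j = increasing (ran K) j"
      using that by (simp add: seq_ins_def)
    moreover have "j < card (ran K)" if "finite (ran K)"
      using card_mono[OF that, of "ran K \<inter> {..<k}"] \<open>j < ?p\<close> by auto
    then have "increasing (ran K) j \<noteq> None" by (auto simp: increasing_def)
    ultimately show ?thesis
      using \<sigma>(1) unfolding sorts_def by (metis option.map_disc_iff)
  qed
  have "\<exists>\<rho>. permutation \<rho> \<and> (\<forall>x. x \<notin> insert k (ran ?L) \<longrightarrow> \<rho> x = x) \<and> sign \<rho> = (-1) ^ ?p \<and>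
    (\<forall>j. map_option \<rho> (seq_ins k 0 ?L j) = seq_ins k ?p ?L j)"
    by (rule seq_ins_move_front[OF L_def injL kL])
  then obtain \<tau> where \<tau>: "permutation \<tau>" "\<And>x. x \<notin> ran K \<Longrightarrow> \<tau> x = x" "sign \<tau> = (-1) ^ ?p"
    "\<And>j. map_option \<tau> (seq_ins k 0 ?L j) = seq_ins k ?p ?L j" unfolding ranK by blast
  have \<sigma>k: "\<sigma> k = k" using \<sigma>(1) kL by (simp add: sorts_def)
  have "\<forall>j. map_option \<sigma> (seq_ins k ?p ?L j) = seq_ins k ?p (increasing (ran ?L)) j"
    using \<sigma>(1) \<sigma>k by (simp add: seq_ins_def sorts_def)
  then have \<sigma>K: "map_option (\<sigma> \<circ> \<tau>) (seq_ins k 0 ?L j) = increasing (ran K) j" for j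
    unfolding ranL increasing_insert[OF kK] by (simp flip: \<tau>(4) add: option.map_comp)
  have \<pi>K: "map_option (\<pi> \<circ> \<rho>) (seq_ins k 0 ?L j) = increasing (ran K) j" for j
    using \<pi>(1) by (simp add: sorts_def flip: \<rho>(4) option.map_comp)
  \<comment> \<open>both sides sort the sequence with \<open>k\<close> in front, and both fix all other numbers\<close>
  have "\<pi> \<circ> \<rho> = \<sigma> \<circ> \<tau>"
  proof
    fix x
    show "(\<pi> \<circ> \<rho>) x = (\<sigma> \<circ> \<tau>) x"
    proof (cases "x \<in> ran K")
      case True
      then have "x \<in> ran (seq_ins k 0 ?L)" by (simp add: ran_seq_ins ranK)
      then obtain j where j: "seq_ins k 0 ?L j = Some x" by (auto simp: ran_def)
      show ?thesis using \<sigma>K[of j] \<pi>K[of j] by (simp add: j) (metis option.inject)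
    next
      case False
      then show ?thesis using \<pi>(1) \<sigma>(1) \<rho>(2) \<tau>(2) by (simp add: sorts_def ranL)
    qed
  qed
  then have "sign (\<pi> \<circ> \<rho>) = sign (\<sigma> \<circ> \<tau>)" by simp
  then have "sign \<pi> * (-1) ^ i = sign \<sigma> * (-1) ^ ?p"
    using \<pi>(1) \<sigma>(1) by (simp add: sign_compose \<rho> \<tau> sorts_def)
  moreover have "(-1) ^ ?p * (-1) ^ ?p = (1 :: int)" by (simp flip: power_mult_distrib)
  ultimately have "sign \<sigma> = sign \<pi> * (-1) ^ (i + ?p)"
    by (metis mult.assoc mult.right_neutral power_add)
  then show "seq_sign ?L = seq_sign K * (-1) ^ (i + ?p)" by (simp add: \<pi>(2) \<sigma>(2))
qed

section \<open>Minors with respect to increasing index sets\<close>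

abbreviation coeffs :: "(ell2 \<Rightarrow> ell2) \<Rightarrow> nat \<Rightarrow> nat \<Rightarrow> real" where
  "coeffs T i j \<equiv> inner (T (basis_vec i)) (basis_vec j)"

lemma sorted_list_nth_card:
  fixes R :: "nat set"
  assumes "finite R" "x \<in> R"
  shows "sorted_list_of_set R ! card (R \<inter> {..<x}) = x"
    and "card (R \<inter> {..<x}) < card R"
proof -
  let ?s = "sorted_list_of_set R"
  have s: "sorted_wrt (<) ?s" "set ?s = R" "length ?s = card R" "distinct ?s"
    using assms by auto
  obtain q where q: "q < card R" "?s ! q = x"
    using assms(2) s by (metis in_set_conv_nth)
  have "R \<inter> {..<x} = (!) ?s ` {..<q}"
  proof (intro equalityI subsetI)
    fix y assume y: "y \<in> R \<inter> {..<x}"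
    then obtain p where p: "p < card R" "?s ! p = y" using s by (metis IntD1 in_set_conv_nth)
    have "p < q"
    proof (rule ccontr)
      assume "\<not> p < q"
      then have "x \<le> y" using s(1,3) p q sorted_wrt_nth_less[OF s(1), of q p]
        by (cases "p = q") auto
      then show False using y by simp
    qed
    then show "y \<in> (!) ?s ` {..<q}" using p by auto
  next
    fix y assume "y \<in> (!) ?s ` {..<q}"
    then obtain p where p: "p < q" "y = ?s ! p" by auto
    then have "y < x" using sorted_wrt_nth_less[OF s(1), of p q] q s(3) by auto
    moreover have "y \<in> R" using p q s(2,3) by (metis nth_mem order_less_trans)
    ultimately show "y \<in> R \<inter> {..<x}" by simp
  qed
  moreover have "inj_on ((!) ?s) {..<q}"
    by (rule inj_on_nth[OF s(4)]) (use q s(3) in auto)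
  ultimately have "card (R \<inter> {..<x}) = q" by (simp add: card_image)
  then show "?s ! card (R \<inter> {..<x}) = x" "card (R \<inter> {..<x}) < card R" using q by simp_all
qed

lemma sorted_list_nth_mem:
  assumes "q < card R"
  shows "sorted_list_of_set R ! q \<in> R"
  using assms by (metis card.infinite length_sorted_list_of_set not_less_zero nth_mem
      set_sorted_list_of_set)

lemma card_below_sorted_list_nth:
  fixes R :: "nat set"
  assumes "finite R" "q < card R"
  shows "card (R \<inter> {..<sorted_list_of_set R ! q}) = q"
proof -
  have "distinct (sorted_list_of_set R)" by simp
  then show ?thesis
    using sorted_list_nth_card[OF assms(1) sorted_list_nth_mem[OF assms(2)]] assms(2)
    by (metis length_sorted_list_of_set nth_eq_iff_index_eq)
qed

lemma sorted_list_nth_remove: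
  fixes R :: "nat set"
  assumes R: "finite R" "k \<in> R" and q: "q < card R - 1"
  shows "sorted_list_of_set (R - {k}) ! q =
    sorted_list_of_set R ! (if q < card (R \<inter> {..<k}) then q else Suc q)"
proof -
  let ?y = "sorted_list_of_set (R - {k}) ! q"
  have q': "q < card (R - {k})" using R q by simp
  have y: "?y \<in> R - {k}" by (rule sorted_list_nth_mem) (use R q' in auto)
  have c: "card ((R - {k}) \<inter> {..<?y}) = q" by (rule card_below_sorted_list_nth) (use R q' in auto)
  have "card (R \<inter> {..<?y}) = (if q < card (R \<inter> {..<k}) then q else Suc q)"
  proof (cases "?y < k")
    case True
    then have "(R - {k}) \<inter> {..<?y} = R \<inter> {..<?y}" by auto
    moreover have "card (R \<inter> {..<?y}) < card (R \<inter> {..<k})"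
      by (rule psubset_card_mono) (use True y in auto)
    ultimately show ?thesis using c by simp
  next
    case False
    then have "R \<inter> {..<?y} = insert k ((R - {k}) \<inter> {..<?y})" using y R by auto
    then have "card (R \<inter> {..<?y}) = Suc q" using c by (simp add: card_insert_if)
    moreover have "card (R \<inter> {..<k}) \<le> card ((R - {k}) \<inter> {..<?y})"
      by (rule card_mono) (use False y in auto)
    ultimately show ?thesis using c by simp
  qed
  then show ?thesis using sorted_list_nth_card(1)[OF R(1), of ?y] y by simp
qed

lemma minor_det_cong:
  assumes "\<And>i j. i \<in> R \<Longrightarrow> j \<in> C \<Longrightarrow> M i j = M' i j"
  shows "minor_det M R C = minor_det M' R C"
  unfolding minor_det_def
  by (rule arg_cong[where f = Determinant.det], rule cong_mat)
    (auto intro!: assms sorted_list_nth_mem)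

lemma minor_det_empty: "minor_det M {} {} = 1"
  unfolding minor_det_def by (simp add: det_dim_zero)

text \<open>Laplace expansion along a row with a single entry; the position of an index in the increasing order
  is again the number of smaller elements.\<close>

lemma minor_det_expand_row:
  assumes R: "finite R" "k \<in> R" and C: "finite C" "l \<in> C" and card: "card R = card C"
    and zero: "\<And>i. i \<in> R \<Longrightarrow> i \<noteq> k \<Longrightarrow> M i l = 0"
  shows "minor_det M R C =
    (-1) ^ (card (R \<inter> {..<k}) + card (C \<inter> {..<l})) * M k l * minor_det M (R - {k}) (C - {l})"
proof -
  let ?n = "card R" and ?pk = "card (R \<inter> {..<k})" and ?pl = "card (C \<inter> {..<l})"
  let ?r = "sorted_list_of_set R" and ?c = "sorted_list_of_set C"
  define X where "X = Matrix.mat (card C) (card R) (\<lambda>(p, q). M (?r ! q) (?c ! p))"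
  have X: "X \<in> carrier_mat ?n ?n" unfolding X_def using card by simp
  have pk: "?pk < ?n" "?r ! ?pk = k" and pl: "?pl < card C" "?c ! ?pl = l"
    using sorted_list_nth_card[OF R] sorted_list_nth_card[OF C] by simp_all
  have idx: "X $$ (p, q) = M (?r ! q) (?c ! p)" if "p < ?n" "q < ?n" for p q
    using that card by (simp add: X_def)
  have row0: "X $$ (?pl, q) = 0" if "q < ?n" "q \<noteq> ?pk" for q
  proof -
    have "?r ! q \<noteq> k"
      using card_below_sorted_list_nth[OF R(1) that(1)] that(2) by auto
    then show ?thesis
      using that pl card zero[OF sorted_list_nth_mem[OF that(1)]] by (simp add: idx)
  qed
  have "minor_det M R C = det X" by (simp add: minor_det_def X_def)
  also have "\<dots> = (\<Sum>q<?n. X $$ (?pl, q) * cofactor X ?pl q)"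
    by (rule laplace_expansion_row[OF X]) (use pl card in simp)
  also have "\<dots> = (\<Sum>q\<in>{?pk}. X $$ (?pl, q) * cofactor X ?pl q)"
    by (rule sum.mono_neutral_right) (use pk row0 in auto)
  also have "\<dots> = M k l * cofactor X ?pl ?pk" using pk pl card by (simp add: idx)
  also have "mat_delete X ?pl ?pk = Matrix.mat (card (C - {l})) (card (R - {k}))
      (\<lambda>(p, q). M (sorted_list_of_set (R - {k}) ! q) (sorted_list_of_set (C - {l}) ! p))"
    unfolding mat_delete_def
  proof (rule cong_mat)
    show "dim_row X - 1 = card (C - {l})" "dim_col X - 1 = card (R - {k})"
      using R C card X by auto
    fix p q assume "p < dim_row X - 1" "q < dim_col X - 1"
    then have p: "p < card C - 1" and q: "q < card R - 1" using X card by auto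
    show "(case (p, q) of (i', j') \<Rightarrow>
        X $$ (if i' < ?pl then i' else Suc i', if j' < ?pk then j' else Suc j')) =
      (case (p, q) of (p, q) \<Rightarrow>
        M (sorted_list_of_set (R - {k}) ! q) (sorted_list_of_set (C - {l}) ! p))"
      using p q card idx by (simp add: sorted_list_nth_remove[OF R q] sorted_list_nth_remove[OF C p])
  qed
  then have "cofactor X ?pl ?pk = (-1) ^ (?pk + ?pl) * minor_det M (R - {k}) (C - {l})"
    by (simp add: cofactor_def minor_det_def add.commute)
  finally show ?thesis by simp
qed

lemma minor_det_mult:
  assumes fin: "finite X" "finite Y" "finite Z" and card: "card X = card Y" "card Y = card Z"
    and M: "\<And>i j. i \<in> X \<Longrightarrow> j \<in> Z \<Longrightarrow> M i j = (\<Sum>l\<in>Y. N l j * L i l)"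
  shows "minor_det M X Z = minor_det N Y Z * minor_det L X Y"
proof -
  let ?x = "sorted_list_of_set X" and ?y = "sorted_list_of_set Y" and ?z = "sorted_list_of_set Z"
  let ?n = "card X"
  define A where "A = Matrix.mat ?n ?n (\<lambda>(p, q). N (?y ! q) (?z ! p))"
  define B where "B = Matrix.mat ?n ?n (\<lambda>(p, q). L (?x ! q) (?y ! p))"
  have AB: "A \<in> carrier_mat ?n ?n" "B \<in> carrier_mat ?n ?n" by (simp_all add: A_def B_def)
  have bij: "bij_betw ((!) ?y) {0..<?n} Y"
    by (rule bij_betw_nth) (use fin card in auto)
  have "Matrix.mat (card Z) (card X) (\<lambda>(p, q). M (?x ! q) (?z ! p)) = A * B"
  proof (rule eq_matI)
    fix p q assume "p < dim_row (A * B)" "q < dim_col (A * B)"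
    then have pq: "p < ?n" "q < ?n" using AB by auto
    have "M (?x ! q) (?z ! p) = (\<Sum>l\<in>Y. N l (?z ! p) * L (?x ! q) l)"
      by (rule M; rule sorted_list_nth_mem) (use fin card pq in auto)
    also have "\<dots> = (\<Sum>r = 0..<?n. N (?y ! r) (?z ! p) * L (?x ! q) (?y ! r))"
      by (rule sum.reindex_bij_betw[OF bij, symmetric])
    also have "\<dots> = (A * B) $$ (p, q)"
      using pq by (simp add: A_def B_def scalar_prod_def)
    finally show "Matrix.mat (card Z) (card X) (\<lambda>(p, q). M (?x ! q) (?z ! p)) $$ (p, q) = (A * B) $$ (p, q)"
      using pq card by simp
  qed (use card AB in auto)
  then have "minor_det M X Z = det (A * B)" by (simp add: minor_det_def)
  also have "\<dots> = det A * det B" by (rule det_mult[OF AB])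
  finally show ?thesis using card by (simp add: minor_det_def A_def B_def)
qed

lemma minor_det_tendsto:
  assumes "finite R" "finite C" "card R = card C"
    and lim: "\<And>i j. i \<in> R \<Longrightarrow> j \<in> C \<Longrightarrow> ((\<lambda>n. M n i j) \<longlongrightarrow> M0 i j) F"
  shows "((\<lambda>n. minor_det (M n) R C) \<longlongrightarrow> minor_det M0 R C) F"
proof -
  let ?n = "card R"
  let ?r = "sorted_list_of_set R" and ?c = "sorted_list_of_set C"
  have *: "minor_det M' R C =
      (\<Sum>p\<in>{p. p permutes {0..<?n}}. signof p * (\<Prod>i = 0..<?n. M' (?r ! p i) (?c ! i)))" for M'
  proof -
    have "minor_det M' R C = det (Matrix.mat ?n ?n (\<lambda>(p, q). M' (?r ! q) (?c ! p)))"
      by (simp add: minor_det_def assms)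
    also have "\<dots> = (\<Sum>p\<in>{p. p permutes {0..<?n}}. signof p *
        (\<Prod>i = 0..<?n. Matrix.mat ?n ?n (\<lambda>(p, q). M' (?r ! q) (?c ! p)) $$ (i, p i)))"
      by (rule det_def') simp
    also have "\<dots> = (\<Sum>p\<in>{p. p permutes {0..<?n}}. signof p * (\<Prod>i = 0..<?n. M' (?r ! p i) (?c ! i)))"
    proof (intro sum.cong prod.cong refl arg_cong2[where f = "(*)"])
      fix p i assume "p \<in> {p. p permutes {0..<?n}}" "i \<in> {0..<?n}"
      then have "p i < ?n" "i < ?n" using permutes_in_image[of p "{0..<?n}" i] by auto
      then show "Matrix.mat ?n ?n (\<lambda>(p, q). M' (?r ! q) (?c ! p)) $$ (i, p i) = M' (?r ! p i) (?c ! i)"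
        by simp
    qed
    finally show ?thesis .
  qed
  show ?thesis
    unfolding *
  proof (intro tendsto_sum tendsto_mult tendsto_const tendsto_prod)
    fix p i assume "p \<in> {p. p permutes {0..<?n}}" "i \<in> {0..<?n}"
    then have "p i < ?n" "i < ?n" using permutes_in_image[of p "{0..<?n}" i] by auto
    then show "((\<lambda>n. M n (?r ! p i) (?c ! i)) \<longlongrightarrow> M0 (?r ! p i) (?c ! i)) F"
      by (intro lim sorted_list_nth_mem) (use assms in auto)
  qed
qed

section \<open>Index sets that differ in finitely many places\<close>

text \<open>Beyond \<open>N\<close> the increasing enumerations of \<open>A\<close> and \<open>B\<close> run in step, so that square matrices indexed
  by the two sets can be cut off at \<open>N\<close>.\<close>

definition aligned :: "nat \<Rightarrow> nat set \<Rightarrow> nat set \<Rightarrow> bool" where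
  "aligned N A B \<longleftrightarrow> card (A \<inter> {..<N}) = card (B \<inter> {..<N}) \<and> (\<forall>m\<ge>N. m \<in> A \<longleftrightarrow> m \<in> B)"

lemma Int_lessThan_Suc:
  "A \<inter> {..<Suc n} = (if n \<in> A then insert n (A \<inter> {..<n}) else A \<inter> {..<n})"
  by (auto simp: less_Suc_eq)

lemma aligned_iff:
  assumes "M \<le> N" "\<And>m. m \<ge> M \<Longrightarrow> m \<in> A \<longleftrightarrow> m \<in> B"
  shows "aligned M A B \<longleftrightarrow> aligned N A B"
proof -
  have "card (A \<inter> {..<M}) = card (B \<inter> {..<M}) \<longleftrightarrow> card (A \<inter> {..<N}) = card (B \<inter> {..<N})"
    using assms(1)
  proof (induction rule: dec_induct)
    case (step n)
    then show ?case using assms(2)[of n] by (auto simp: Int_lessThan_Suc card_insert_if)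
  qed simp
  then show ?thesis using assms by (auto simp: aligned_def)
qed

lemma aligned_mono: "aligned M A B \<Longrightarrow> M \<le> N \<Longrightarrow> aligned N A B"
  using aligned_iff[of M N A B] by (simp add: aligned_def)

lemma aligned_sym: "aligned N A B \<Longrightarrow> aligned N B A"
  by (simp add: aligned_def)

lemma aligned_trans: "aligned N A B \<Longrightarrow> aligned N B C \<Longrightarrow> aligned N A C"
  by (simp add: aligned_def)

lemma aligned_remove:
  assumes "aligned N A B" "k \<in> A" "l \<in> B" "k < N" "l < N"
  shows "aligned N (A - {k}) (B - {l})"
proof -
  have "(A - {k}) \<inter> {..<N} = A \<inter> {..<N} - {k}" "(B - {l}) \<inter> {..<N} = B \<inter> {..<N} - {l}" by auto
  then show ?thesis using assms by (simp add: aligned_def)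
qed

text \<open>This form makes it evident that the relation is an equivalence and survives the removal of one
  element on each side.\<close>

lemma sim_iff_aligned: "sim A B \<longleftrightarrow> A \<noteq> {} \<and> B \<noteq> {} \<and> (\<exists>N. aligned N A B)"
proof (intro iffI conjI)
  assume s: "sim A B"
  then show "A \<noteq> {}" "B \<noteq> {}" by (simp_all add: sim_def)
  obtain K1 K2 where K: "K1 \<subseteq> A" "K2 \<subseteq> - A" "finite K1" "finite K2" "card K1 = card K2"
    "B = (A - K1) \<union> K2" using s by (auto simp: sim_def)
  obtain N where N: "\<And>m. m \<in> K1 \<union> K2 \<Longrightarrow> m < N"
    using finite_nat_bounded[of "K1 \<union> K2"] K(3,4) by auto
  have "B \<inter> {..<N} = (A \<inter> {..<N} - K1) \<union> K2" using K(6) N by auto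
  moreover have "card ((A \<inter> {..<N} - K1) \<union> K2) = card (A \<inter> {..<N} - K1) + card K2"
    by (rule card_Un_disjoint) (use K in auto)
  moreover have "card (A \<inter> {..<N} - K1) = card (A \<inter> {..<N}) - card K1"
    by (rule card_Diff_subset) (use K N in auto)
  moreover have "card K1 \<le> card (A \<inter> {..<N})" by (rule card_mono) (use K N in auto)
  ultimately have "card (A \<inter> {..<N}) = card (B \<inter> {..<N})" using K(5) by simp
  moreover have "m \<in> A \<longleftrightarrow> m \<in> B" if "m \<ge> N" for m using that N[of m] K(6) by auto
  ultimately show "\<exists>N. aligned N A B" unfolding aligned_def by blast
next
  assume *: "A \<noteq> {} \<and> B \<noteq> {} \<and> (\<exists>N. aligned N A B)"
  then obtain N where N: "aligned N A B" by blast
  have sub: "A - B \<subseteq> {..<N}" "B - A \<subseteq> {..<N}"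
    using N by (auto simp: aligned_def not_less[symmetric])
  have fin: "finite (A - B)" "finite (B - A)" using sub by (auto intro: finite_subset)
  have "card (A \<inter> {..<N}) = card (A - B) + card (A \<inter> B \<inter> {..<N})"
    using sub fin by (subst card_Un_disjoint[symmetric]) (auto intro!: arg_cong[where f = card])
  moreover have "card (B \<inter> {..<N}) = card (B - A) + card (A \<inter> B \<inter> {..<N})"
    using sub fin by (subst card_Un_disjoint[symmetric]) (auto intro!: arg_cong[where f = card])
  ultimately have "card (A - B) = card (B - A)" using N by (simp add: aligned_def)
  then show "sim A B"
    using * fin unfolding sim_def by (intro conjI exI[of _ "A - B"] exI[of _ "B - A"]) auto
qed

lemma sim_sym: "sim A B \<Longrightarrow> sim B A"
  by (auto simp: sim_iff_aligned dest: aligned_sym)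

lemma sim_trans: "sim A B \<Longrightarrow> sim B C \<Longrightarrow> sim A C"
  unfolding sim_iff_aligned
  by (metis aligned_mono aligned_trans max.cobounded1 max.cobounded2)

lemma sim_remove:
  assumes "sim A B" "k \<in> A" "l \<in> B" "A - {k} \<noteq> {}"
  shows "sim (A - {k}) (B - {l})"
proof -
  obtain N0 where N0: "aligned N0 A B" using assms by (auto simp: sim_iff_aligned)
  obtain r where r: "r \<in> A - {k}" using assms by blast
  let ?N = "Suc (N0 + k + l + r)"
  have al: "aligned ?N (A - {k}) (B - {l})"
    by (rule aligned_remove[OF aligned_mono[OF N0]]) (use assms in auto)
  have "r \<in> (A - {k}) \<inter> {..<?N}" using r by simp
  then have "card ((A - {k}) \<inter> {..<?N}) \<noteq> 0" by (metis card_0_eq empty_iff finite_Int finite_lessThan)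
  then have "card ((B - {l}) \<inter> {..<?N}) \<noteq> 0" using al unfolding aligned_def by metis
  then have "B - {l} \<noteq> {}" by (metis Int_empty_left card.empty)
  then show ?thesis using al assms by (auto simp: sim_iff_aligned)
qed

section \<open>Determinants of operators between coordinate subspaces\<close>

text \<open>The type of operator to which the determinant applies: its component in a common direction of the two
  subspaces is the coordinate itself.\<close>

definition unit_rows :: "nat set \<Rightarrow> nat set \<Rightarrow> (ell2 \<Rightarrow> ell2) \<Rightarrow> bool" where
  "unit_rows A B T \<longleftrightarrow> (\<forall>i\<in>A. \<forall>j\<in>A \<inter> B. coeffs T i j = (if i = j then 1 else 0))"

text \<open>The rows added when the matrix is cut off later are rows of the identity, and the indices added occupy
  the same position on both sides.  The freedom in \<open>N\<close> allows operators between several pairs of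
  subspaces to be compared in matrices of one size.\<close>

lemma op_det_aligned:
  assumes al: "aligned N A B" and T: "unit_rows A B T"
  shows "op_det A B T = minor_det (coeffs T) (A \<inter> {..<N}) (B \<inter> {..<N})"
proof -
  define m where "m = (if A = B then 0 else Suc (Max ((A - B) \<union> (B - A))))"
  have "(A - B) \<union> (B - A) \<subseteq> {..<N}"
    using al by (auto simp: aligned_def not_less[symmetric])
  then have fin: "finite ((A - B) \<union> (B - A))" by (rule finite_subset) simp
  have ge: "n \<in> A \<longleftrightarrow> n \<in> B" if "n \<ge> m" for n
    using that Max_ge[OF fin, of n] by (auto simp: m_def split: if_splits)
  have "m \<le> N"
  proof (cases "A = B")
    case False
    then have "Max ((A - B) \<union> (B - A)) \<in> (A - B) \<union> (B - A)" by (intro Max_in fin) auto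
    then have "Max ((A - B) \<union> (B - A)) < N"
      using \<open>(A - B) \<union> (B - A) \<subseteq> {..<N}\<close> by blast
    then show ?thesis by (simp add: m_def)
  qed (simp add: m_def)
  have "aligned m A B \<longleftrightarrow> aligned N A B" by (rule aligned_iff[OF \<open>m \<le> N\<close> ge])
  with al have al_m: "aligned m A B" by blast
  have sets: "(A - B) \<union> hat A B = A \<inter> {..<m}" "(B - A) \<union> hat A B = B \<inter> {..<m}"
  proof -
    define M where "M = Max ((A - B) \<union> (B - A))"
    have M: "x \<le> M" if "x \<in> A - B \<or> x \<in> B - A" for x
      unfolding M_def by (rule Max_ge[OF fin]) (use that in blast)
    have "hat A B = {i \<in> A \<inter> B. i \<le> M} \<and> m = Suc M" if "A \<noteq> B"
      using that by (simp add: hat_def m_def M_def)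
    moreover have "hat A B = {} \<and> m = 0" if "A = B"
      using that by (simp add: hat_def m_def)
    ultimately show "(A - B) \<union> hat A B = A \<inter> {..<m}" "(B - A) \<union> hat A B = B \<inter> {..<m}"
      using M by (cases "A = B"; fastforce simp: less_Suc_eq_le)+
  qed
  have "minor_det (coeffs T) (A \<inter> {..<m}) (B \<inter> {..<m}) =
      minor_det (coeffs T) (A \<inter> {..<N}) (B \<inter> {..<N})"
    using \<open>m \<le> N\<close>
  proof (induction rule: dec_induct)
    case (step n)
    show ?case
    proof (cases "n \<in> A")
      case True
      then have n: "n \<in> A" "n \<in> B" using ge[of n] step by auto
      have al_n: "card (A \<inter> {..<n}) = card (B \<inter> {..<n})"
        using aligned_mono[OF al_m, of n] step by (simp add: aligned_def)
      have "minor_det (coeffs T) (A \<inter> {..<Suc n}) (B \<inter> {..<Suc n}) =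
        (-1) ^ (card (A \<inter> {..<Suc n} \<inter> {..<n}) + card (B \<inter> {..<Suc n} \<inter> {..<n})) * coeffs T n n *
        minor_det (coeffs T) (A \<inter> {..<Suc n} - {n}) (B \<inter> {..<Suc n} - {n})"
        by (rule minor_det_expand_row)
          (use n al_n T in \<open>auto simp: unit_rows_def Int_lessThan_Suc\<close>)
      moreover have "A \<inter> {..<Suc n} \<inter> {..<n} = A \<inter> {..<n}" "B \<inter> {..<Suc n} \<inter> {..<n} = B \<inter> {..<n}"
        "A \<inter> {..<Suc n} - {n} = A \<inter> {..<n}" "B \<inter> {..<Suc n} - {n} = B \<inter> {..<n}" by auto
      moreover have "coeffs T n n = 1" using T n by (simp add: unit_rows_def)
      ultimately show ?thesis using step al_n by (simp flip: mult_2)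
    next
      case False
      then have "n \<notin> B" using ge[of n] step by auto
      with False show ?thesis using step by (simp add: Int_lessThan_Suc)
    qed
  qed simp
  then show ?thesis by (simp add: op_det_def sets)
qed

lemma ell2_eqI: "(\<And>j. inner x (basis_vec j) = inner y (basis_vec j)) \<Longrightarrow> x = y"
  by (simp add: inner_basis_vec Rep_ell2_inject[symmetric] ext)

lemma inner_basis_basis: "inner (basis_vec i) (basis_vec j) = (if i = j then 1 else 0)"
  by (simp add: inner_basis_vec basis_vec.rep_eq)

lemma inner_proj: "inner (proj I x) (basis_vec j) = (if j \<in> I then inner x (basis_vec j) else 0)"
  by (simp add: inner_basis_vec proj.rep_eq)

lemma ell2_finite_expansion:
  assumes "finite Y" "\<And>j. j \<notin> Y \<Longrightarrow> inner x (basis_vec j) = 0"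
  shows "x = (\<Sum>l\<in>Y. inner x (basis_vec l) *\<^sub>R basis_vec l)"
proof (rule ell2_eqI)
  fix j
  have "inner (\<Sum>l\<in>Y. inner x (basis_vec l) *\<^sub>R basis_vec l) (basis_vec j)
      = (\<Sum>l\<in>Y. if l = j then inner x (basis_vec l) else 0)"
    by (auto simp: inner_sum_left inner_basis_basis intro!: sum.cong)
  then show "inner x (basis_vec j) = inner (\<Sum>l\<in>Y. inner x (basis_vec l) *\<^sub>R basis_vec l) (basis_vec j)"
    using assms by auto
qed

lemma minor_det_compose:
  assumes fin: "finite X" "finite Y" "finite Z" and card: "card X = card Y" "card Y = card Z"
    and T: "linear T" and L: "\<And>i j. i \<in> X \<Longrightarrow> j \<notin> Y \<Longrightarrow> coeffs L i j = 0"
  shows "minor_det (coeffs (\<lambda>v. T (L v))) X Z = minor_det (coeffs T) Y Z * minor_det (coeffs L) X Y"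
proof (rule minor_det_mult[OF fin card])
  fix i j assume "i \<in> X" "j \<in> Z"
  have "T (L (basis_vec i)) = T (\<Sum>l\<in>Y. coeffs L i l *\<^sub>R basis_vec l)"
    using ell2_finite_expansion[OF fin(2), of "L (basis_vec i)"] L[OF \<open>i \<in> X\<close>] by simp
  also have "\<dots> = (\<Sum>l\<in>Y. coeffs L i l *\<^sub>R T (basis_vec l))"
    by (simp add: linear_sum[OF T] linear_scale[OF T])
  finally show "coeffs (\<lambda>v. T (L v)) i j = (\<Sum>l\<in>Y. coeffs T l j * coeffs L i l)"
    by (simp add: inner_sum_left mult.commute)
qed

text \<open>After a common cut-off this is the multiplicativity of finite determinants: \<open>L\<close> sends the first basis
  vectors of \<open>A\<close> into the span of the first basis vectors of \<open>B\<close>, because its later rows are rows of the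
  identity.\<close>

lemma op_det_compose:
  assumes sim: "sim A B" "sim B C" and T: "linear T" "unit_rows B C T"
    and L: "unit_rows A B L" "\<And>i j. i \<in> A \<Longrightarrow> j \<notin> B \<Longrightarrow> coeffs L i j = 0"
    and TL: "unit_rows A C (\<lambda>v. T (L v))"
  shows "op_det A C (\<lambda>v. T (L v)) = op_det B C T * op_det A B L"
proof -
  obtain N where N: "aligned N A B" "aligned N B C"
    using sim unfolding sim_iff_aligned by (metis aligned_mono max.cobounded1 max.cobounded2)
  have AC: "aligned N A C" by (rule aligned_trans[OF N])
  have "minor_det (coeffs (\<lambda>v. T (L v))) (A \<inter> {..<N}) (C \<inter> {..<N}) =
      minor_det (coeffs T) (B \<inter> {..<N}) (C \<inter> {..<N}) *
      minor_det (coeffs L) (A \<inter> {..<N}) (B \<inter> {..<N})"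
  proof (rule minor_det_compose[OF _ _ _ _ _ T(1)])
    fix i j assume i: "i \<in> A \<inter> {..<N}" and j: "j \<notin> B \<inter> {..<N}"
    show "coeffs L i j = 0"
    proof (cases "j \<in> B")
      case True
      then have "j \<ge> N" "j \<in> A" using j N(1) by (auto simp: aligned_def)
      then show ?thesis using L(1) i True by (auto simp: unit_rows_def)
    qed (use L(2) i in auto)
  qed (use N in \<open>simp_all add: aligned_def\<close>)
  then show ?thesis
    by (simp add: op_det_aligned[OF N(1) L(1)] op_det_aligned[OF N(2) T(2)] op_det_aligned[OF AC TL])
qed

section \<open>Coordinate projections\<close>

lemma proj_proj: "proj I (proj J x) = proj (I \<inter> J) x"
  by (rule ell2_eqI) (simp add: inner_proj)

lemma proj_same [simp]: "proj I (proj I x) = proj I x"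
  by (simp add: proj_proj)

lemma linear_proj: "linear (proj I)"
  by (rule linearI; rule ell2_eqI) (simp_all add: inner_proj inner_add_left)

lemma norm_proj_le: "norm (proj I x) \<le> norm x"
proof -
  have "(norm (proj I x))\<^sup>2 \<le> (norm x)\<^sup>2"
    unfolding ell2_norm_sq by (intro suminf_le ell2_sq_summable) (simp add: proj.rep_eq)
  then show ?thesis by (rule power2_le_imp_le) simp
qed

lemma bounded_linear_proj: "bounded_linear (proj I)"
  using norm_proj_le[of I] linear_proj[of I]
  by (intro bounded_linear.intro bounded_linear_axioms.intro exI[of _ 1]) simp_all

lemmas proj_add = linear_add[OF linear_proj]
  and proj_diff = linear_diff[OF linear_proj]
  and proj_scale = linear_scale[OF linear_proj]
  and proj_zero = linear_0[OF linear_proj]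

lemma proj_basis: "proj I (basis_vec i) = (if i \<in> I then basis_vec i else 0)"
  by (rule ell2_eqI) (auto simp: inner_proj inner_basis_basis)

lemma subsp_iff: "x \<in> subsp I \<longleftrightarrow> proj I x = x"
  by (metis proj_same rangeE rangeI)

lemma proj_compl: "x \<in> subsp (- I) \<Longrightarrow> proj I x = 0"
  by (rule ell2_eqI) (auto simp: inner_proj)

section \<open>Tangent projections\<close>

text \<open>\<open>Q\<close> is the projection, along the closed span of the basis vectors outside \<open>I\<close>, onto a graph over the
  subspace with coordinates in \<open>I\<close>: the equations imply \<open>Q (Q v) = Q v\<close>.\<close>

definition tangent_proj :: "nat set \<Rightarrow> (ell2 \<Rightarrow> ell2) \<Rightarrow> bool" where
  "tangent_proj I Q \<longleftrightarrow> linear Q \<and> (\<forall>v. proj I (Q v) = proj I v) \<and> (\<forall>v. Q (proj I v) = Q v)"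

lemma unit_rows_tangent_proj:
  assumes "tangent_proj I Q"
  shows "unit_rows I J (\<lambda>v. proj J (Q v))"
  unfolding unit_rows_def
proof (intro ballI)
  fix i j assume *: "i \<in> I" "j \<in> I \<inter> J"
  then have "coeffs (\<lambda>v. proj J (Q v)) i j = inner (proj I (Q (basis_vec i))) (basis_vec j)"
    by (simp add: inner_proj)
  also have "\<dots> = inner (proj I (basis_vec i)) (basis_vec j)"
    using assms by (simp add: tangent_proj_def)
  finally show "coeffs (\<lambda>v. proj J (Q v)) i j = (if i = j then 1 else 0)"
    using * by (simp add: inner_proj inner_basis_basis)
qed

text \<open>The chain rule for coordinate changes.  The hypothesis says that the range of \<open>\<beta>\<close> lies in the range
  of \<open>Q\<close>; passing from \<open>I\<close> to \<open>B\<close> may then be done by way of \<open>A\<close>.\<close>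

lemma op_det_tangent_compose:
  assumes sim: "sim I A" "sim A B" and \<beta>: "tangent_proj I \<beta>" and Q: "tangent_proj A Q"
    and Q_\<beta>: "\<And>v. Q (\<beta> v) = \<beta> v"
  shows "op_det I B (\<lambda>v. proj B (\<beta> v)) =
    op_det A B (\<lambda>v. proj B (Q v)) * op_det I A (\<lambda>v. proj A (\<beta> v))"
proof -
  have eq: "proj B (Q (proj A (\<beta> v))) = proj B (\<beta> v)" for v
    using Q Q_\<beta>[of v] by (simp add: tangent_proj_def)
  have lin: "linear (\<lambda>v. proj B (Q v))"
    using linear_compose[of Q "proj B"] Q linear_proj by (simp add: tangent_proj_def o_def)
  have rows: "unit_rows I B (\<lambda>v. proj B (Q (proj A (\<beta> v))))"
    unfolding eq by (rule unit_rows_tangent_proj[OF \<beta>])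
  have "op_det I B (\<lambda>v. proj B (Q (proj A (\<beta> v)))) =
      op_det A B (\<lambda>v. proj B (Q v)) * op_det I A (\<lambda>v. proj A (\<beta> v))"
    by (rule op_det_compose[OF sim lin unit_rows_tangent_proj[OF Q] unit_rows_tangent_proj[OF \<beta>] _ rows])
      (simp add: inner_proj)
  then show ?thesis by (simp add: eq)
qed

text \<open>Delete the rows of the identity one after another: row and column stand at the same position, so no
  sign appears.\<close>

lemma minor_det_unipotent_row:
  assumes "finite Z" "k \<notin> Z" and M: "\<And>i j. i \<in> insert k Z \<Longrightarrow> j \<in> Z \<Longrightarrow> M i j = (if i = j then 1 else 0)"
  shows "minor_det M (insert k Z) (insert k Z) = M k k"
  using assms
proof (induction Z rule: finite_induct)
  case empty
  show ?case
    by (subst minor_det_expand_row[of "{k}" k "{k}" k]) (simp_all add: minor_det_empty flip: mult_2)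
next
  case (insert z Z)
  have "minor_det M (insert k (insert z Z)) (insert k (insert z Z)) = M z z *
      minor_det M (insert k (insert z Z) - {z}) (insert k (insert z Z) - {z})"
    by (subst minor_det_expand_row[of _ z _ z]) (use insert in \<open>auto simp flip: mult_2\<close>)
  moreover have "insert k (insert z Z) - {z} = insert k Z" using insert by auto
  moreover have "minor_det M (insert k Z) (insert k Z) = M k k"
    by (rule insert.IH) (use insert.prems in auto)
  moreover have "M z z = 1" using insert.prems(2)[of z z] by simp
  ultimately show ?case by simp
qed

text \<open>\<open>Q\<close> projects onto a space \<open>T\<close> with coordinates in \<open>A\<close>; \<open>P\<close> and \<open>P'\<close> project onto a hyperplane of \<open>T\<close>
  with coordinates in \<open>A - {k}\<close> and in \<open>B - {l}\<close>.  Let \<open>E\<close> be the unipotent change of basis that tilts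
  the span of \<open>A - {k}\<close> into the \<open>A\<close>-coordinates of the hyperplane and keeps the basis vector of \<open>k\<close>, and
  \<open>E'\<close> the corresponding one for \<open>B\<close> and \<open>l\<close>.  In the tilted bases the coordinate change becomes block
  triangular: the blocks are the coordinate change of the hyperplane and the number \<open>c\<close>, by which the
  transversal direction is multiplied modulo the hyperplane.  The sign comes from moving \<open>k\<close> and \<open>l\<close>
  from their places in the increasing orders to the corner of the matrix.\<close>

lemma op_det_hypersurface:
  assumes sim: "sim A B" and k: "k \<in> A" and l: "l \<in> B"
    and Q: "tangent_proj A Q" and P: "tangent_proj (A - {k}) P" and P': "tangent_proj (B - {l}) P'"
    and QP: "\<And>v. Q (P v) = P v" and P'P: "\<And>v. P' (P v) = P v"
  defines "c \<equiv> inner (Q (basis_vec k) - P' (Q (basis_vec k))) (basis_vec l)"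
  shows "op_det A B (\<lambda>v. proj B (Q v)) =
    (-1) ^ (card (A \<inter> {..<k}) + card (B \<inter> {..<l})) * c *
      op_det (A - {k}) (B - {l}) (\<lambda>v. proj (B - {l}) (P v))"
proof -
  let ?ek = "basis_vec k" and ?el = "basis_vec l" and ?R = "A - {k}" and ?R' = "B - {l}"
  obtain N0 where N0: "aligned N0 A B" using sim by (auto simp: sim_iff_aligned)
  define N where "N = Suc (N0 + k + l)"
  have kN: "k < N" and lN: "l < N" by (simp_all add: N_def)
  have al: "aligned N A B" by (rule aligned_mono[OF N0]) (simp add: N_def)
  define X Y where "X = A \<inter> {..<N}" and "Y = B \<inter> {..<N}"
  have fin: "finite X" "finite Y" by (simp_all add: X_def Y_def)
  have kX: "k \<in> X" and lY: "l \<in> Y" using k l kN lN by (simp_all add: X_def Y_def)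
  have card: "card X = card Y" using al by (simp add: aligned_def X_def Y_def)
  have RX: "?R \<inter> {..<N} = X - {k}" and RY: "?R' \<inter> {..<N} = Y - {l}" by (auto simp: X_def Y_def)
  have al': "aligned N ?R ?R'" by (rule aligned_remove[OF al k l kN lN])
  note tp = Q[unfolded tangent_proj_def] P[unfolded tangent_proj_def] P'[unfolded tangent_proj_def]
  have linQ: "linear Q" and linP: "linear P" and linP': "linear P'" using tp by auto
  \<comment> \<open>\<open>T\<close> is the coordinate change and \<open>T'\<close> its block triangular form in the tilted bases\<close>
  define T where "T v = proj B (Q v)" for v
  define E where "E v = proj A (P v) + inner v ?ek *\<^sub>R ?ek" for v
  define E' where "E' v = proj B (P' v) + inner v ?el *\<^sub>R ?el" for v
  define w where "w = proj ?R' (Q ?ek) + c *\<^sub>R ?el"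
  define T' where "T' v = proj ?R' (P v) + inner v ?ek *\<^sub>R w" for v
  have linT: "linear T"
    unfolding T_def using linear_compose[OF linQ linear_proj] by (simp add: o_def)
  have linE': "linear E'"
    unfolding E'_def
    by (rule linearI) (simp_all add: linear_add[OF linP'] linear_scale[OF linP'] proj_add proj_scale
        inner_add_left algebra_simps)
  have Pk: "P ?ek = 0"
  proof -
    have "P ?ek = P (proj ?R ?ek)" using tp by simp
    then show ?thesis by (simp add: proj_basis linear_0[OF linP])
  qed
  have P_coord: "inner (P v) (basis_vec j) = inner v (basis_vec j)" if "j \<in> ?R" for v j
  proof -
    have "inner (proj ?R (P v)) (basis_vec j) = inner (proj ?R v) (basis_vec j)" using tp by simp
    then show ?thesis using that by (simp add: inner_proj)
  qed
  have P'_coord: "inner (P' v) (basis_vec j) = inner v (basis_vec j)" if "j \<in> ?R'" for v j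
  proof -
    have "inner (proj ?R' (P' v)) (basis_vec j) = inner (proj ?R' v) (basis_vec j)" using tp by simp
    then show ?thesis using that by (simp add: inner_proj)
  qed
  have TE: "T (E (basis_vec i)) = E' (T' (basis_vec i))" for i
  proof (cases "i = k")
    case False
    have "T (E (basis_vec i)) = proj B (Q (proj A (P (basis_vec i))))"
      using False by (simp add: T_def E_def inner_basis_basis)
    also have "\<dots> = proj B (P' (P (basis_vec i)))" using tp QP P'P by simp
    also have "\<dots> = E' (T' (basis_vec i))"
      using False tp by (simp add: E'_def T'_def inner_basis_basis inner_proj)
    finally show ?thesis .
  next
    case True
    have "P' w = P' (proj ?R' w)" using tp by simp
    also have "proj ?R' w = proj ?R' (Q ?ek)" by (simp add: w_def proj_add proj_scale proj_basis)
    finally have "P' w = P' (Q ?ek)" using tp by simp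
    moreover have "inner w ?el = c" by (simp add: w_def inner_add_left inner_proj inner_basis_basis)
    ultimately have E'w: "E' w = proj B (P' (Q ?ek)) + c *\<^sub>R ?el" by (simp add: E'_def)
    have "proj B (Q ?ek) = proj B (P' (Q ?ek)) + c *\<^sub>R ?el"
    proof (rule ell2_eqI)
      fix j
      show "inner (proj B (Q ?ek)) (basis_vec j) =
          inner (proj B (P' (Q ?ek)) + c *\<^sub>R ?el) (basis_vec j)"
        using l P'_coord[of j "Q ?ek"]
        by (auto simp: inner_proj inner_add_left inner_basis_basis c_def inner_diff_left)
    qed
    then show ?thesis
      using True by (simp add: T_def E_def T'_def Pk proj_zero inner_basis_basis E'w)
  qed
  have "minor_det (coeffs (\<lambda>v. T (E v))) X Y = minor_det (coeffs T) X Y * minor_det (coeffs E) X X"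
  proof (rule minor_det_compose[OF fin(1) fin(1) fin(2) refl card linT])
    fix i j assume i: "i \<in> X" and j: "j \<notin> X"
    then have "j \<noteq> k" "i \<noteq> j" using kX by auto
    then show "coeffs E i j = 0"
      using P_coord[of j "basis_vec i"] by (simp add: E_def inner_add_left inner_proj inner_basis_basis)
  qed
  moreover have "minor_det (coeffs E) (insert k (X - {k})) (insert k (X - {k})) = coeffs E k k"
  proof (rule minor_det_unipotent_row)
    fix i j assume "i \<in> insert k (X - {k})" and j: "j \<in> X - {k}"
    then show "coeffs E i j = (if i = j then 1 else 0)"
      using P_coord[of j "basis_vec i"]
      by (simp add: E_def inner_add_left inner_proj inner_basis_basis X_def)
  qed (use fin in auto)
  moreover have "coeffs E k k = 1" by (simp add: E_def Pk proj_zero inner_basis_basis)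
  moreover have "minor_det (coeffs (\<lambda>v. E' (T' v))) X Y =
      minor_det (coeffs E') Y Y * minor_det (coeffs T') X Y"
  proof (rule minor_det_compose[OF fin(1) fin(2) fin(2) card refl linE'])
    fix i j assume i: "i \<in> X" and j: "j \<notin> Y"
    have jl: "j \<noteq> l" using j lY by auto
    show "coeffs T' i j = 0"
    proof (cases "j \<in> B")
      case True
      then have "j \<ge> N" using j by (auto simp: Y_def)
      then have jA: "j \<in> A" using True al by (simp add: aligned_def)
      have jk: "j \<noteq> k" "i \<noteq> j" using \<open>j \<ge> N\<close> kN i by (auto simp: X_def)
      have "inner (Q ?ek) (basis_vec j) = inner (proj A (Q ?ek)) (basis_vec j)"
        using jA by (simp add: inner_proj)
      also have "\<dots> = 0" using tp jk by (simp add: inner_proj inner_basis_basis)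
      finally show ?thesis
        using P_coord[of j "basis_vec i"] jA jk jl True
        by (simp add: T'_def w_def inner_add_left inner_proj inner_basis_basis)
    qed (use jl in \<open>simp add: T'_def w_def inner_add_left inner_proj inner_basis_basis\<close>)
  qed
  moreover have "minor_det (coeffs E') (insert l (Y - {l})) (insert l (Y - {l})) = coeffs E' l l"
  proof (rule minor_det_unipotent_row)
    fix i j assume "i \<in> insert l (Y - {l})" and j: "j \<in> Y - {l}"
    then show "coeffs E' i j = (if i = j then 1 else 0)"
      using P'_coord[of j "basis_vec i"]
      by (simp add: E'_def inner_add_left inner_proj inner_basis_basis Y_def)
  qed (use fin in auto)
  moreover have "coeffs E' l l = 1"
  proof -
    have "P' ?el = P' (proj ?R' ?el)" using tp by simp
    then have "P' ?el = 0" by (simp add: proj_basis linear_0[OF linP'])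
    then show ?thesis by (simp add: E'_def proj_zero inner_basis_basis)
  qed
  moreover have "insert k (X - {k}) = X" "insert l (Y - {l}) = Y" using kX lY by auto
  ultimately have TT': "minor_det (coeffs T) X Y = minor_det (coeffs T') X Y" by (simp add: TE)
  have "minor_det (coeffs T') X Y = (-1) ^ (card (X \<inter> {..<k}) + card (Y \<inter> {..<l})) *
      coeffs T' k l * minor_det (coeffs T') (X - {k}) (Y - {l})"
    by (rule minor_det_expand_row[OF fin(1) kX fin(2) lY card])
      (simp add: T'_def inner_add_left inner_proj inner_basis_basis)
  moreover have "X \<inter> {..<k} = A \<inter> {..<k}" "Y \<inter> {..<l} = B \<inter> {..<l}"
    using kN lN by (auto simp: X_def Y_def)
  moreover have "coeffs T' k l = c"
    by (simp add: T'_def w_def Pk proj_zero inner_basis_basis inner_add_left inner_proj)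
  moreover have "minor_det (coeffs T') (X - {k}) (Y - {l}) =
      minor_det (coeffs (\<lambda>v. proj ?R' (P v))) (X - {k}) (Y - {l})"
    by (rule minor_det_cong) (simp add: T'_def inner_basis_basis)
  moreover have "op_det A B (\<lambda>v. proj B (Q v)) = minor_det (coeffs T) X Y"
    unfolding X_def Y_def T_def by (rule op_det_aligned[OF al unit_rows_tangent_proj[OF Q]])
  moreover have "op_det ?R ?R' (\<lambda>v. proj ?R' (P v)) =
      minor_det (coeffs (\<lambda>v. proj ?R' (P v))) (X - {k}) (Y - {l})"
    using op_det_aligned[OF al' unit_rows_tangent_proj[OF P]] by (simp only: RX RY)
  ultimately show ?thesis using TT' by simp
qed

lemma op_det_tendsto:
  assumes "sim A B" and "\<And>n. tangent_proj A (Q n)" and "tangent_proj A Q0"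
    and lim: "\<And>v. ((\<lambda>n. Q n v) \<longlongrightarrow> Q0 v) F"
  shows "((\<lambda>n. op_det A B (\<lambda>v. proj B (Q n v))) \<longlongrightarrow> op_det A B (\<lambda>v. proj B (Q0 v))) F"
proof -
  obtain N where N: "aligned N A B" using assms(1) by (auto simp: sim_iff_aligned)
  show ?thesis
    unfolding op_det_aligned[OF N unit_rows_tangent_proj[OF assms(2)]]
      op_det_aligned[OF N unit_rows_tangent_proj[OF assms(3)]]
    by (rule minor_det_tendsto)
      (use N in \<open>auto simp: aligned_def inner_proj intro!: tendsto_inner lim tendsto_const\<close>)
qed

lemma op_det_cong:
  assumes "\<And>i. i \<in> I \<Longrightarrow> T (basis_vec i) = T' (basis_vec i)"
  shows "op_det I J T = op_det I J T'"
  unfolding op_det_def by (rule minor_det_cong) (use assms in \<open>auto simp: hat_def split: if_splits\<close>)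

section \<open>Graphs as local retractions\<close>

text \<open>When \<open>f\<close> takes its values in the complementary subspace, this is the identity on the graph of \<open>f\<close>, hence
  a retraction onto it.  Unlike \<open>f\<close>, it can be differentiated in all directions of the whole space, and
  its derivative is therefore unique.\<close>

definition graph_map :: "nat set \<Rightarrow> (ell2 \<Rightarrow> ell2) \<Rightarrow> ell2 \<Rightarrow> ell2" where
  "graph_map I f z = proj I z + f (proj I z)"

lemma graph_map_cong_proj: "proj I z = proj I z' \<Longrightarrow> graph_map I f z = graph_map I f z'"
  by (simp add: graph_map_def)

lemma graph_map_derivative_shift:
  assumes "(graph_map I f has_derivative Q) (at x)" "proj I x = proj I y"
  shows "(graph_map I f has_derivative Q) (at y)"
proof -
  have "((\<lambda>z. z + (x - y)) has_derivative (\<lambda>v. v)) (at y)"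
    by (auto intro!: derivative_eq_intros)
  then have "((\<lambda>z. graph_map I f (z + (x - y))) has_derivative (\<lambda>v. Q v)) (at y)"
    by (rule has_derivative_compose) (use assms in simp)
  moreover have "graph_map I f (z + (x - y)) = graph_map I f z" for z
    by (rule graph_map_cong_proj) (simp add: proj_add proj_diff assms)
  ultimately show ?thesis by simp
qed

lemma has_derivative_proj: "(proj I has_derivative proj I) F"
  by (rule bounded_linear_imp_has_derivative[OF bounded_linear_proj])

text \<open>Differentiate \<open>P\<^sub>I (r z) = P\<^sub>I z\<close> and \<open>r (P\<^sub>I z) = r z\<close>.\<close>

lemma graph_map_tangent_proj:
  assumes Q: "(graph_map I f has_derivative Q) (at x)"
    and "open V" "x \<in> V" "\<And>z. z \<in> V \<Longrightarrow> f (proj I z) \<in> subsp (- I)"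
  shows "tangent_proj I Q"
proof -
  have lin: "linear Q" using has_derivative_bounded_linear[OF Q] by (rule bounded_linear.linear)
  have "((\<lambda>z. proj I (graph_map I f z)) has_derivative (\<lambda>v. proj I (Q v))) (at x)"
    by (rule has_derivative_compose[OF Q has_derivative_proj])
  then have "(proj I has_derivative (\<lambda>v. proj I (Q v))) (at x)"
    by (rule has_derivative_transform_within_open[OF _ assms(2,3)])
      (simp add: graph_map_def proj_add proj_compl[OF assms(4)])
  then have 1: "(\<lambda>v. proj I (Q v)) = proj I"
    by (rule has_derivative_unique[OF _ has_derivative_proj])
  have "((\<lambda>z. graph_map I f (proj I z)) has_derivative (\<lambda>v. Q (proj I v))) (at x)"
    by (rule has_derivative_compose[OF has_derivative_proj graph_map_derivative_shift[OF Q]]) simp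
  then have "(\<lambda>v. Q (proj I v)) = Q"
    by (intro has_derivative_unique[OF _ Q]) (simp add: graph_map_def[abs_def])
  with 1 lin show ?thesis unfolding tangent_proj_def by metis
qed

lemma retraction_derivative_fixes:
  assumes r: "(r has_derivative Q) (at x)" and s: "(s has_derivative P) (at x)" and "r x = x"
    and V: "open V" "x \<in> V" "\<And>z. z \<in> V \<Longrightarrow> s (r z) = r z"
  shows "P (Q v) = Q v"
proof -
  have "((\<lambda>z. s (r z)) has_derivative (\<lambda>v. P (Q v))) (at x)"
    by (rule has_derivative_compose[OF r]) (simp add: assms)
  then have "(r has_derivative (\<lambda>v. P (Q v))) (at x)"
    by (rule has_derivative_transform_within_open[OF _ V])
  then have "(\<lambda>v. P (Q v)) = Q" by (rule has_derivative_unique[OF _ r])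
  then show ?thesis by metis
qed

text \<open>Restrict to the line through \<open>y\<close> in the direction \<open>v\<close>, which stays inside the subspace.\<close>

lemma derivative_within_subsp_unique:
  assumes D: "(g has_derivative D1) (at y within subsp I)" "(g has_derivative D2) (at y within subsp I)"
    and y: "y \<in> subsp I" and v: "v \<in> subsp I"
  shows "D1 v = D2 v"
proof -
  let ?l = "\<lambda>t :: real. y + t *\<^sub>R v"
  have sub: "range ?l \<subseteq> subsp I"
    using y v by (auto simp: subsp_iff proj_add proj_scale)
  have l: "(?l has_derivative (\<lambda>t. t *\<^sub>R v)) (at 0)" by (auto intro!: derivative_eq_intros)
  have "((\<lambda>t. g (?l t)) has_derivative (\<lambda>t. D (t *\<^sub>R v))) (at 0)"
    if "(g has_derivative D) (at y within subsp I)" for D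
    by (rule has_derivative_in_compose[OF l]) (use has_derivative_subset[OF that sub] in simp)
  from has_derivative_unique[OF this[OF D(1)] this[OF D(2)]]
  have "D1 (1 *\<^sub>R v) = D2 (1 *\<^sub>R v)" by metis
  then show ?thesis by simp
qed

lemma transition_graph_map:
  assumes Q: "(graph_map I f has_derivative Q) (at x)"
  shows "transition J f differentiable (at (proj I x) within subsp I)"
    and "transition_det I f J x = op_det I J (\<lambda>v. proj J (Q v))"
proof -
  have "((\<lambda>z. proj J (graph_map I f z)) has_derivative (\<lambda>v. proj J (Q v))) (at (proj I x))"
    by (rule has_derivative_compose[OF graph_map_derivative_shift[OF Q] has_derivative_proj]) simp
  then have "((\<lambda>z. proj J (graph_map I f z)) has_derivative (\<lambda>v. proj J (Q v)))
      (at (proj I x) within subsp I)"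
    by (rule has_derivative_at_withinI)
  then have D: "(transition J f has_derivative (\<lambda>v. proj J (Q v))) (at (proj I x) within subsp I)"
    by (rule has_derivative_transform[rotated 2])
      (auto simp: transition_def graph_map_def)
  then show diff: "transition J f differentiable (at (proj I x) within subsp I)"
    by (rule differentiableI)
  show "transition_det I f J x = op_det I J (\<lambda>v. proj J (Q v))"
    unfolding transition_det_def
  proof (rule op_det_cong)
    fix i assume "i \<in> I"
    then have "basis_vec i \<in> subsp I" by (simp add: subsp_iff proj_basis)
    then show "frechet_derivative (transition J f) (at (proj I x) within subsp I) (basis_vec i) =
        proj J (Q (basis_vec i))"
      using diff by (intro derivative_within_subsp_unique[OF _ D])
        (auto simp: frechet_derivative_works)
  qed
qed

lemma open_proj_vimage:
  assumes "openin (top_of_set (subsp I)) V"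
  shows "open {z. proj I z \<in> V}"
proof -
  obtain O' where O': "open O'" "V = subsp I \<inter> O'" using assms by (auto simp: openin_open)
  have "{z. proj I z \<in> V} = proj I -` O'" using O' by auto
  moreover have "continuous_on UNIV (proj I)"
    by (rule linear_continuous_on[OF bounded_linear_proj])
  ultimately show ?thesis using O'(1) by (simp add: open_vimage continuous_on_open_vimage)
qed

text \<open>Composition with the projection turns differentiability relative to a subspace into
  differentiability on an open set.  Pointwise continuity of the derivative is what the
  determinants need.\<close>

lemma C1_on_extend:
  assumes "C1_on I V f"
  obtains Df where "open {z. proj I z \<in> V}"
    "\<And>z. proj I z \<in> V \<Longrightarrow> ((\<lambda>z. f (proj I z)) has_derivative Df z) (at z)"
    "\<And>z v. Df z v = Df z (proj I v)"
    "\<And>v. continuous_on {z. proj I z \<in> V} (\<lambda>z. Df z v)"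
proof -
  obtain f' where op: "openin (top_of_set (subsp I)) V"
    and f': "\<And>y. y \<in> V \<Longrightarrow> (f has_derivative blinfun_apply (f' y)) (at y within subsp I)"
    and cont: "continuous_on V f'"
    using assms unfolding C1_on_def by blast
  define Df where "Df z v = blinfun_apply (f' (proj I z)) (proj I v)" for z v
  have "((\<lambda>z. f (proj I z)) has_derivative Df z) (at z)" if "proj I z \<in> V" for z
    unfolding Df_def by (rule has_derivative_in_compose[OF has_derivative_proj f'[OF that]])
  moreover have "continuous_on {z. proj I z \<in> V} (\<lambda>z. Df z v)" for v
  proof -
    have "continuous_on {z. proj I z \<in> V} (\<lambda>z. f' (proj I z))"
      by (rule continuous_on_compose2[OF cont linear_continuous_on[OF bounded_linear_proj]]) auto
    then show ?thesis unfolding Df_def by (intro continuous_intros)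
  qed
  ultimately show thesis
    by (intro that[of Df] open_proj_vimage[OF op]) (simp_all add: Df_def)
qed

section \<open>Boundary charts\<close>

lemma C1_on_add_scaleR:
  assumes f: "C1_on I V f" and g: "C1_on I V g"
  shows "C1_on I V (\<lambda>y. f y *\<^sub>R e + g y)"
proof -
  obtain f' where f': "\<And>y. y \<in> V \<Longrightarrow> (f has_derivative blinfun_apply (f' y)) (at y within subsp I)"
    "continuous_on V f'" using f unfolding C1_on_def by blast
  obtain g' where g': "\<And>y. y \<in> V \<Longrightarrow> (g has_derivative blinfun_apply (g' y)) (at y within subsp I)"
    "continuous_on V g'" using g unfolding C1_on_def by blast
  let ?D = "\<lambda>y. (blinfun_scaleR_left e o\<^sub>L f' y) + g' y"
  have "((\<lambda>y. f y *\<^sub>R e + g y) has_derivative blinfun_apply (?D y)) (at y within subsp I)"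
    if "y \<in> V" for y
    using f'(1)[OF that] g'(1)[OF that]
    by (auto intro!: derivative_eq_intros simp: blinfun.add_left)
  moreover have "continuous_on V ?D"
    by (intro continuous_intros f'(2) g'(2))
  moreover have "openin (top_of_set (subsp I)) V" using f by (simp add: C1_on_def)
  ultimately show ?thesis unfolding C1_on_def by (intro conjI exI[of _ ?D]) blast+
qed

text \<open>The function whose graph over \<open>dV d\<close> is the boundary patch.\<close>

definition edge_fun :: "bdatum \<Rightarrow> ell2 \<Rightarrow> ell2" where
  "edge_fun d y = dh d y *\<^sub>R basis_vec (dk d) + dPhi d y"

abbreviation edge_map :: "bdatum \<Rightarrow> ell2 \<Rightarrow> ell2" where
  "edge_map d \<equiv> graph_map (dred d) (edge_fun d)"

abbreviation collar_map :: "bdatum \<Rightarrow> ell2 \<Rightarrow> ell2" where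
  "collar_map d \<equiv> graph_map (dset d) (\<lambda>y. dPhi d (proj (dred d) y))"

abbreviation chart_dom :: "bdatum \<Rightarrow> ell2 set" where
  "chart_dom d \<equiv> {z. proj (dred d) z \<in> dV d}"

lemma bdatum_index:
  assumes "is_bdatum I0 D x d"
  shows "dk d \<in> dset d" and "sim (dset d) I0" and "ran (seq_del (dK d) (dpos d)) = dred d"
    and "dred d \<noteq> {}"
    and "seq_sign (seq_del (dK d) (dpos d)) = (-1) ^ (dpos d + card (dset d \<inter> {..<dk d}))"
proof -
  have d: "dK d \<in> SF" "seq_sign (dK d) = 1" "dpos d \<in> dom (dK d)"
    "seq_del (dK d) (dpos d) \<in> SF" "dset d \<in> Gam I0"
    using assms by (simp_all add: is_bdatum_def)
  then have k: "dK d (dpos d) = Some (dk d)" by (auto simp: dk_def)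
  then show "dk d \<in> dset d" unfolding dset_def by (rule ranI)
  show "sim (dset d) I0" using d by (simp add: Gam_def)
  show *: "ran (seq_del (dK d) (dpos d)) = dred d"
    using seq_sign_seq_del(1)[OF d(1) k d(4)] by (simp add: dred_def dset_def)
  have "dom (seq_del (dK d) (dpos d)) \<noteq> {}" using d(4) by (simp add: SF_def is_seq_def)
  then obtain j l where "seq_del (dK d) (dpos d) j = Some l" by fast
  from ranI[of "seq_del (dK d) (dpos d)", OF this] show "dred d \<noteq> {}" unfolding * by blast
  show "seq_sign (seq_del (dK d) (dpos d)) = (-1) ^ (dpos d + card (dset d \<inter> {..<dk d}))"
    using seq_sign_seq_del(2)[OF d(1) k d(4)] d(2) by (simp add: dset_def)
qed

lemma dred_subset: "dred d \<inter> dset d = dred d" "dk d \<notin> dred d"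
  by (auto simp: dred_def)

lemma proj_dred_dset: "proj (dred d) (proj (dset d) z) = proj (dred d) z"
  by (simp add: proj_proj dred_subset)

lemma collar_map_eq: "collar_map d z = proj (dset d) z + dPhi d (proj (dred d) z)"
  by (simp add: graph_map_def proj_dred_dset)

lemma dPhi_subsp:
  assumes "is_bdatum I0 D x d" "y \<in> dV d"
  shows "dPhi d y \<in> subsp (- dset d)"
  using assms by (auto simp: is_bdatum_def)

lemma edge_fun_subsp:
  assumes "is_bdatum I0 D x d" "y \<in> dV d"
  shows "edge_fun d y \<in> subsp (- dred d)"
proof -
  have "proj (- dset d) (dPhi d y) = dPhi d y"
    using dPhi_subsp[OF assms] by (simp add: subsp_iff)
  moreover have "- dred d \<inter> - dset d = - dset d" by (auto simp: dred_def)
  ultimately have "proj (- dred d) (dPhi d y) = dPhi d y" by (metis proj_proj)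
  then show ?thesis
    by (simp add: subsp_iff edge_fun_def proj_add proj_scale proj_basis dred_subset)
qed

lemma dV_subsp:
  assumes "is_bdatum I0 D x d" "y \<in> dV d"
  shows "proj (dred d) y = y"
proof -
  have "openin (top_of_set (subsp (dred d))) (dV d)" using assms(1) by (simp add: is_bdatum_def)
  then have "y \<in> subsp (dred d)" using openin_imp_subset assms(2) by blast
  then show ?thesis by (simp only: subsp_iff)
qed

lemma collar_point:
  assumes d: "is_bdatum I0 D x d" and y: "y \<in> dUK d" and w: "w = y + dPhi d (proj (dred d) y)"
  shows "proj (dset d) w = y" "w \<in> chart_dom d" "collar_map d w = w"
proof -
  have V: "proj (dred d) y \<in> dV d" using d y by (auto simp: is_bdatum_def)
  have "openin (top_of_set (subsp (dset d))) (dUK d)" using d by (simp add: is_bdatum_def)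
  then have "y \<in> subsp (dset d)" using openin_imp_subset y by blast
  then have yA: "proj (dset d) y = y" by (simp only: subsp_iff)
  show 1: "proj (dset d) w = y"
    using proj_compl[OF dPhi_subsp[OF d V]] by (simp add: w proj_add yA)
  have 2: "proj (dred d) w = proj (dred d) y" using proj_dred_dset[of d w] by (simp add: 1)
  show "w \<in> chart_dom d" using V by (simp add: 2)
  show "collar_map d w = w" unfolding collar_map_eq 1 2 by (rule w[symmetric])
qed

lemma collar_fix:
  assumes "is_bdatum I0 D x d" "w \<in> D \<inter> dU d"
  shows "w \<in> chart_dom d" "collar_map d w = w"
proof -
  have "w \<in> {y + dPhi d (proj (dred d) y) | y. y \<in> dUK d \<and> rho d y \<le> 0}"
    using assms by (simp add: is_bdatum_def)
  then obtain y where "y \<in> dUK d" "w = y + dPhi d (proj (dred d) y)" by blast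
  then show "w \<in> chart_dom d" "collar_map d w = w" using collar_point[OF assms(1)] by blast+
qed

lemma admissible_bdatum: "admissible I0 S D x d \<Longrightarrow> is_bdatum I0 D x d"
  by (simp add: admissible_def)

lemma admissible_edge:
  assumes "admissible I0 S D x d"
  shows "boundary_pts I0 D \<inter> dU d = {y + edge_fun d y | y. y \<in> dV d}"
  using assms by (simp add: admissible_def Let_def edge_fun_def add.assoc)

lemma edge_point:
  assumes d: "is_bdatum I0 D x d" and y: "y \<in> dV d"
  shows "proj (dred d) (y + edge_fun d y) = y"
  using proj_compl[OF edge_fun_subsp[OF d y]] dV_subsp[OF d y] by (simp add: proj_add)

lemma edge_fix:
  assumes d: "admissible I0 S D x d" and w: "w \<in> boundary_pts I0 D \<inter> dU d"
  shows "w \<in> chart_dom d" "edge_map d w = w"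
proof -
  obtain y where y: "y \<in> dV d" "w = y + edge_fun d y"
    using w unfolding admissible_edge[OF d] by blast
  then have "proj (dred d) w = y" using edge_point[OF admissible_bdatum[OF d]] by simp
  then show "w \<in> chart_dom d" "edge_map d w = w" using y by (simp_all add: graph_map_def)
qed

lemma edge_in:
  assumes d: "admissible I0 S D x d" and z: "z \<in> chart_dom d"
  shows "edge_map d z \<in> boundary_pts I0 D \<inter> dU d"
  using z unfolding admissible_edge[OF d] graph_map_def by blast

text \<open>The direction of \<open>dk d\<close> is one in which \<open>dPhi d\<close> has no component.\<close>

lemma inner_edge_map:
  assumes d: "is_bdatum I0 D x d" and z: "z \<in> chart_dom d"
  shows "inner (edge_map d z) (basis_vec (dk d)) = dh d (proj (dred d) z)"
proof -
  have "dPhi d (proj (dred d) z) \<in> subsp (- dset d)" using dPhi_subsp[OF d] z by simp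
  then have "inner (dPhi d (proj (dred d) z)) (basis_vec (dk d)) = 0"
    using bdatum_index(1)[OF d] by (auto simp: inner_proj)
  then show ?thesis
    by (simp add: graph_map_def edge_fun_def inner_add_left inner_proj inner_basis_basis dred_subset)
qed

text \<open>The factor \<open>(-1)\<close> to the power \<open>dpos d - 1\<close> in \<open>rho\<close> is the opposite of \<open>(-1)\<close> to the power
  \<open>dpos d\<close>, and \<open>rho\<close> is negative on the interior.\<close>

lemma interior_side:
  assumes d: "admissible I0 S D x d" and w: "w \<in> interior_pts I0 S D \<inter> dU d"
  shows "(-1) ^ dpos d * inner (w - edge_map d w) (basis_vec (dk d)) > 0"
proof -
  have "w \<in> {y + dPhi d (proj (dred d) y) | y. y \<in> dUK d \<and> rho d y < 0}"
    using d w by (simp add: admissible_def Let_def)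
  then obtain y where y: "y \<in> dUK d" "w = y + dPhi d (proj (dred d) y)" "rho d y < 0" by blast
  note p = collar_point[OF admissible_bdatum[OF d] y(1,2)]
  have "inner w (basis_vec (dk d)) = inner (proj (dset d) w) (basis_vec (dk d))"
    using bdatum_index(1)[OF admissible_bdatum[OF d]] by (simp add: inner_proj)
  then have 1: "inner y (basis_vec (dk d)) = inner w (basis_vec (dk d))" by (simp add: p(1))
  have 2: "proj (dred d) y = proj (dred d) w" using proj_dred_dset[of d w] by (simp add: p(1))
  have sign: "(-1 :: real) powi (int n - 1) = - ((-1) ^ n)" for n
    by (cases n) (simp_all add: power_int_minus)
  show ?thesis
    using y(3) inner_edge_map[OF admissible_bdatum[OF d] p(2)]
    by (simp add: rho_def 1 2 sign inner_diff_left)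
qed

lemma open_chart_dom: "is_bdatum I0 D x d \<Longrightarrow> open (chart_dom d)"
  by (rule open_proj_vimage) (simp add: is_bdatum_def)

text \<open>The basis vector of \<open>dk d\<close> is fixed because \<open>dPhi d\<close> enters only through the remaining
  coordinates: the collar is a cylinder in this direction.\<close>

lemma collar_derivative:
  assumes d: "is_bdatum I0 D x d"
  obtains Q where "\<And>z. z \<in> chart_dom d \<Longrightarrow> (collar_map d has_derivative Q z) (at z)"
    "\<And>z. z \<in> chart_dom d \<Longrightarrow> tangent_proj (dset d) (Q z)"
    "\<And>z. z \<in> chart_dom d \<Longrightarrow> Q z (basis_vec (dk d)) = basis_vec (dk d)"
    "\<And>v. continuous_on (chart_dom d) (\<lambda>z. Q z v)"
proof -
  have "C1_on (dred d) (dV d) (dPhi d)" using d by (simp add: is_bdatum_def)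
  then obtain D\<Phi> where D\<Phi>: "\<And>z. z \<in> chart_dom d \<Longrightarrow> ((\<lambda>z. dPhi d (proj (dred d) z)) has_derivative D\<Phi> z) (at z)"
    "\<And>z v. D\<Phi> z v = D\<Phi> z (proj (dred d) v)" "\<And>v. continuous_on (chart_dom d) (\<lambda>z. D\<Phi> z v)"
    by (rule C1_on_extend) auto
  define Q where "Q z v = proj (dset d) v + D\<Phi> z v" for z v
  have Q: "(collar_map d has_derivative Q z) (at z)" if "z \<in> chart_dom d" for z
    unfolding collar_map_eq[abs_def] Q_def
    by (intro has_derivative_add has_derivative_proj D\<Phi>(1) that)
  show thesis
  proof (rule that[of Q])
    fix z assume z: "z \<in> chart_dom d"
    show "(collar_map d has_derivative Q z) (at z)" by (rule Q[OF z])
    show "tangent_proj (dset d) (Q z)"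
      by (rule graph_map_tangent_proj[OF Q[OF z] open_chart_dom[OF d] z])
        (simp add: proj_dred_dset dPhi_subsp[OF d])
    have "D\<Phi> z (basis_vec (dk d)) = D\<Phi> z 0"
      by (subst D\<Phi>(2)) (simp add: proj_basis dred_subset)
    also have "\<dots> = 0"
      using has_derivative_bounded_linear[OF D\<Phi>(1)[OF z]] by (rule linear_simps(3))
    finally show "Q z (basis_vec (dk d)) = basis_vec (dk d)"
      using bdatum_index(1)[OF d] by (simp add: Q_def proj_basis)
  next
    show "continuous_on (chart_dom d) (\<lambda>z. Q z v)" for v
      unfolding Q_def by (intro continuous_intros D\<Phi>(3))
  qed
qed

lemma C1_on_edge_fun:
  assumes "is_bdatum I0 D x d"
  shows "C1_on (dred d) (dV d) (edge_fun d)"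
  unfolding edge_fun_def[abs_def]
  by (rule C1_on_add_scaleR) (use assms in \<open>simp_all add: is_bdatum_def\<close>)

lemma edge_derivative:
  assumes d: "is_bdatum I0 D x d"
  obtains P where "\<And>z. z \<in> chart_dom d \<Longrightarrow> (edge_map d has_derivative P z) (at z)"
    "\<And>z. z \<in> chart_dom d \<Longrightarrow> tangent_proj (dred d) (P z)"
proof -
  obtain De where De: "\<And>z. z \<in> chart_dom d \<Longrightarrow> ((\<lambda>z. edge_fun d (proj (dred d) z)) has_derivative De z) (at z)"
    using C1_on_extend[OF C1_on_edge_fun[OF d]] by (metis (no_types, lifting) mem_Collect_eq)
  have P: "(edge_map d has_derivative (\<lambda>v. proj (dred d) v + De z v)) (at z)"
    if "z \<in> chart_dom d" for z
    unfolding graph_map_def by (intro has_derivative_add has_derivative_proj De that)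
  show thesis
    by (rule that[OF P graph_map_tangent_proj[OF P open_chart_dom[OF d]]])
      (use edge_fun_subsp[OF d] in auto)
qed

lemma continuous_on_derivative:
  assumes "\<And>z. z \<in> V \<Longrightarrow> (g has_derivative Q z) (at z)"
  shows "continuous_on V g"
  using has_derivative_continuous[OF assms] by (auto intro: continuous_at_imp_continuous_on)

section \<open>Orientation of the collars\<close>

lemma surface_chart_retraction:
  assumes W: "(W, I, f) \<in> local_triples J S" and w: "w \<in> W"
  obtains \<beta> U where "(graph_map I f has_derivative \<beta>) (at w)" "tangent_proj I \<beta>"
    "graph_map I f w = w" "open U" "w \<in> U"
    "\<And>z. z \<in> U \<Longrightarrow> graph_map I f z \<in> W" "continuous_on U (graph_map I f)"
proof -
  obtain UI where UI: "C1_on I UI f" "f ` UI \<subseteq> subsp (- I)" "W = {y + f y | y. y \<in> UI}"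
    using W by (auto simp: local_triples_def)
  have "openin (top_of_set (subsp I)) UI" using UI(1) by (simp add: C1_on_def)
  then have sub: "UI \<subseteq> subsp I" by (rule openin_imp_subset)
  let ?U = "{z. proj I z \<in> UI}"
  obtain Df where Df: "open ?U" "\<And>z. z \<in> ?U \<Longrightarrow> ((\<lambda>z. f (proj I z)) has_derivative Df z) (at z)"
    using C1_on_extend[OF UI(1)] by (metis (no_types, lifting) mem_Collect_eq)
  obtain y where y: "y \<in> UI" "w = y + f y" using w UI(3) by blast
  have "proj I y = y" using y(1) sub by (auto simp: subsp_iff[symmetric])
  moreover have "proj I (f y) = 0" by (rule proj_compl) (use y(1) UI(2) in blast)
  ultimately have wy: "proj I w = y" by (simp add: y(2) proj_add)
  then have wU: "w \<in> ?U" using y(1) by simp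
  have D: "(graph_map I f has_derivative (\<lambda>v. proj I v + Df z v)) (at z)" if "z \<in> ?U" for z
    unfolding graph_map_def by (intro has_derivative_add has_derivative_proj Df that)
  show thesis
  proof (rule that[of "\<lambda>v. proj I v + Df w v" ?U])
    show "(graph_map I f has_derivative (\<lambda>v. proj I v + Df w v)) (at w)"
      by (rule D[OF wU])
    then show "tangent_proj I (\<lambda>v. proj I v + Df w v)"
      by (rule graph_map_tangent_proj[OF _ Df(1) wU]) (use UI(2) in blast)
    show "graph_map I f w = w" unfolding graph_map_def wy by (rule y(2)[symmetric])
    show "continuous_on ?U (graph_map I f)" by (rule continuous_on_derivative[OF D])
    show "graph_map I f z \<in> W" if "z \<in> ?U" for z
      using that unfolding UI(3) graph_map_def by blast
  qed (rule Df(1) wU)+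
qed

text \<open>Near an interior point a patch of \<open>A\<close> lies in \<open>D\<close>, where both collar maps are the identity.  By the chain
  rule the determinants of the transitions between the collars are quotients of those of the
  transitions from the patch, which are positive.\<close>

lemma collar_det_interior:
  assumes A: "C1_structure (- I0) S A" and DS: "D \<subseteq> S" and ori: "data_oriented I0 S A D"
    and d: "admissible I0 S D x d" and d': "admissible I0 S D x' d'"
    and w: "w \<in> interior_pts I0 S D" "w \<in> dU d" "w \<in> dU d'"
    and Q: "(collar_map d has_derivative Q) (at w)" "tangent_proj (dset d) Q"
    and Q': "(collar_map d' has_derivative Q') (at w)" "tangent_proj (dset d') Q'"
  shows "op_det (dset d) (dset d') (\<lambda>v. proj (dset d') (Q v)) > 0"
    and "op_det (dset d) (dset d') (\<lambda>v. proj (dset d') (Q v)) *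
      op_det (dset d') (dset d) (\<lambda>v. proj (dset d) (Q' v)) = 1"
proof -
  note bd = admissible_bdatum[OF d] and bd' = admissible_bdatum[OF d']
  obtain W2 I2 f2 where W2: "(W2, I2, f2) \<in> local_triples (- I0) S" "w \<in> W2" "W2 \<subseteq> D"
    and "w \<in> D" using w(1) by (auto simp: interior_pts_def)
  then obtain U2 where U2: "open U2" "W2 = S \<inter> U2" by (auto simp: local_triples_def)
  have "w \<in> (\<Union>(W, I, f)\<in>A. W)" using A \<open>w \<in> D\<close> DS by (auto simp: C1_structure_def)
  then obtain W I f where W: "(W, I, f) \<in> A" "w \<in> W" by auto
  have WT: "(W, I, f) \<in> local_triples (- I0) S" using A W(1) by (auto simp: C1_structure_def)
  then have WS: "W \<subseteq> S" and I: "sim I I0" by (auto simp: local_triples_def Gam_def)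
  obtain \<beta> U where \<beta>: "(graph_map I f has_derivative \<beta>) (at w)" "tangent_proj I \<beta>"
    "graph_map I f w = w" and U: "open U" "w \<in> U" "\<And>z. z \<in> U \<Longrightarrow> graph_map I f z \<in> W"
    "continuous_on U (graph_map I f)"
    using surface_chart_retraction[OF WT W(2)] by metis
  define N where "N = U \<inter> graph_map I f -` (U2 \<inter> dU d \<inter> dU d')"
  have "open (dU d)" "open (dU d')" using bd bd' by (simp_all add: is_bdatum_def)
  then have "open (U2 \<inter> dU d \<inter> dU d')" using U2(1) by (intro open_Int)
  then have "open N" unfolding N_def by (rule continuous_open_preimage[OF U(4,1)])
  moreover have "w \<in> N" unfolding N_def using U(2) U2(2) W2(2) w(2,3) \<beta>(3) by simp
  ultimately have N: "open N" "w \<in> N" .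
  have inD: "graph_map I f z \<in> D \<inter> dU d \<inter> dU d'" if "z \<in> N" for z
    using that U(3) WS U2(2) W2(3) by (auto simp: N_def)
  have Q\<beta>: "Q (\<beta> v) = \<beta> v" for v
    by (rule retraction_derivative_fixes[OF \<beta>(1) Q(1) \<beta>(3) N])
      (use inD collar_fix(2)[OF bd] in blast)
  have Q'\<beta>: "Q' (\<beta> v) = \<beta> v" for v
    by (rule retraction_derivative_fixes[OF \<beta>(1) Q'(1) \<beta>(3) N])
      (use inD collar_fix(2)[OF bd'] in blast)
  let ?A = "dset d" and ?B = "dset d'"
  let ?AB = "op_det ?A ?B (\<lambda>v. proj ?B (Q v))" and ?BA = "op_det ?B ?A (\<lambda>v. proj ?A (Q' v))"
  let ?IA = "op_det I ?A (\<lambda>v. proj ?A (\<beta> v))" and ?IB = "op_det I ?B (\<lambda>v. proj ?B (\<beta> v))"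
  have sim: "sim I ?A" "sim I ?B" "sim ?A ?B" "sim ?B ?A"
    using I bdatum_index(2)[OF bd] bdatum_index(2)[OF bd'] by (meson sim_sym sim_trans)+
  have AB: "?IB = ?AB * ?IA" by (rule op_det_tangent_compose[OF sim(1,3) \<beta>(2) Q(2) Q\<beta>])
  have BA: "?IA = ?BA * ?IB" by (rule op_det_tangent_compose[OF sim(2,4) \<beta>(2) Q'(2) Q'\<beta>])
  have pos: "transition_det I f (dset e) w > 0" if "admissible I0 S D y e" "w \<in> dU e" for y e
    using ori that W w(1) unfolding data_oriented_def by fastforce
  have IA: "?IA > 0" and IB: "?IB > 0"
    using pos[OF d w(2)] pos[OF d' w(3)] by (simp_all add: transition_graph_map(2)[OF \<beta>(1)])
  then show "?AB > 0" using AB by (simp add: zero_less_mult_iff)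
  have "?IB = (?AB * ?BA) * ?IB" using AB BA by (simp add: mult.assoc)
  then show "?AB * ?BA = 1" using IB by simp
qed

lemma directional_slope_tendsto:
  fixes \<gamma> :: "ell2 \<Rightarrow> real"
  assumes \<gamma>: "(\<gamma> has_derivative \<gamma>') (at x)" and s: "s \<longlonglongrightarrow> 0" "\<And>n. s n \<noteq> 0"
  shows "(\<lambda>n. (\<gamma> (x + s n *\<^sub>R e) - \<gamma> x) / s n) \<longlonglongrightarrow> \<gamma>' e"
proof -
  have "((\<lambda>t. x + t *\<^sub>R e) has_derivative (\<lambda>t. t *\<^sub>R e)) (at (0 :: real))"
    by (auto intro!: derivative_eq_intros)
  then have "((\<lambda>t. \<gamma> (x + t *\<^sub>R e)) has_derivative (\<lambda>t. \<gamma>' (t *\<^sub>R e))) (at 0)"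
    by (rule has_derivative_compose) (use \<gamma> in simp)
  moreover have "\<gamma>' (t *\<^sub>R e) = \<gamma>' e * t" for t
    using has_derivative_bounded_linear[OF \<gamma>] by (simp add: linear_simps)
  ultimately have "((\<lambda>t. \<gamma> (x + t *\<^sub>R e)) has_real_derivative \<gamma>' e) (at 0)"
    by (simp add: has_field_derivative_def)
  then have "(\<lambda>t. (\<gamma> (x + (0 + t) *\<^sub>R e) - \<gamma> (x + 0 *\<^sub>R e)) / t) \<midarrow>0\<rightarrow> \<gamma>' e"
    unfolding DERIV_def .
  moreover have "filterlim s (at 0) sequentially"
    using s by (simp add: filterlim_at)
  ultimately have "(\<lambda>n. (\<gamma> (x + (0 + s n) *\<^sub>R e) - \<gamma> (x + 0 *\<^sub>R e)) / s n) \<longlonglongrightarrow> \<gamma>' e"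
    by (rule filterlim_compose)
  then show ?thesis by simp
qed

lemma sign_cancel:
  fixes c m :: real
  assumes "(-1) ^ e * c * m > 0" "(-1) ^ n * c \<ge> 0"
  shows "(-1) ^ (e + n) * m > 0"
proof -
  have "0 < ((-1) ^ e * c * m) * ((-1) ^ n * c)"
  proof (rule mult_pos_pos[OF assms(1)])
    have "(-1) ^ n * c \<noteq> 0" using assms(1) by (cases "c = 0") simp_all
    then show "0 < (-1) ^ n * c" using assms(2) by linarith
  qed
  also have "\<dots> = ((-1) ^ (e + n) * m) * c\<^sup>2"
    by (simp add: power_add power2_eq_square)
  finally show ?thesis by (rule zero_less_mult_pos2) (use assms(1) in \<open>cases "c = 0"; simp\<close>)
qed

text \<open>The sign of the boundary determinant is compared with that of the collar determinant.  The latter is known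
  only at interior points; it passes to the limit along a sequence in the direction of \<open>e\<^sub>k\<close>, which
  at the same time determines the sign of the transversal factor \<open>c\<close>.\<close>

lemma boundary_transition_sign:
  assumes A: "C1_structure (- I0) S A" and D: "D \<subseteq> S" and ori: "data_oriented I0 S A D"
    and d: "admissible I0 S D x0 d" and d': "admissible I0 S D x1 d'"
    and x: "x \<in> boundary_pts I0 D" "x \<in> dU d" "x \<in> dU d'"
    and P: "(edge_map d has_derivative P) (at x)" "tangent_proj (dred d) P"
  shows "seq_sign (seq_del (dK d) (dpos d)) * seq_sign (seq_del (dK d') (dpos d')) *
    op_det (dred d) (dred d') (\<lambda>v. proj (dred d') (P v)) > 0"
proof -
  note bd = admissible_bdatum[OF d] and bd' = admissible_bdatum[OF d']
  let ?A = "dset d" and ?B = "dset d'" and ?k = "dk d" and ?l = "dk d'"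
  let ?ek = "basis_vec ?k" and ?el = "basis_vec ?l"
  have simAB: "sim ?A ?B" and simBA: "sim ?B ?A"
    using bdatum_index(2)[OF bd] bdatum_index(2)[OF bd'] by (meson sim_sym sim_trans)+
  have xd: "x \<in> chart_dom d" "edge_map d x = x" and xd': "x \<in> chart_dom d'" "edge_map d' x = x"
    using edge_fix[OF d] edge_fix[OF d'] x by blast+
  obtain Q where Q: "\<And>z. z \<in> chart_dom d \<Longrightarrow> (collar_map d has_derivative Q z) (at z)"
    "\<And>z. z \<in> chart_dom d \<Longrightarrow> tangent_proj ?A (Q z)"
    "\<And>z. z \<in> chart_dom d \<Longrightarrow> Q z ?ek = ?ek"
    "\<And>v. continuous_on (chart_dom d) (\<lambda>z. Q z v)"
    by (rule collar_derivative[OF bd]) (rule that)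
  obtain Q' where Q': "\<And>z. z \<in> chart_dom d' \<Longrightarrow> (collar_map d' has_derivative Q' z) (at z)"
    "\<And>z. z \<in> chart_dom d' \<Longrightarrow> tangent_proj ?B (Q' z)"
    "\<And>z. z \<in> chart_dom d' \<Longrightarrow> Q' z ?el = ?el"
    "\<And>v. continuous_on (chart_dom d') (\<lambda>z. Q' z v)"
    by (rule collar_derivative[OF bd']) (rule that)
  obtain P' where P': "(edge_map d' has_derivative P') (at x)" "tangent_proj (dred d') P'"
    using edge_derivative[OF bd'] xd'(1) by metis
  obtain Pe where Pe: "\<And>z. z \<in> chart_dom d \<Longrightarrow> (edge_map d has_derivative Pe z) (at z)"
    using edge_derivative[OF bd] by metis

  \<comment> \<open>interior points approach \<open>x\<close> along the line through \<open>x\<close> in the direction of \<open>e\<^sub>k\<close>; the start of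
    the sequence is dropped so that all of them lie in \<open>dU d'\<close>\<close>
  obtain t where t: "\<And>n. t n *\<^sub>R ?ek + proj (dred d) x + dPhi d (proj (dred d) x) \<in> interior_pts I0 S D \<inter> dU d"
    "(\<lambda>n. t n *\<^sub>R ?ek + proj (dred d) x + dPhi d (proj (dred d) x)) \<longlonglongrightarrow> x"
    using d x unfolding admissible_def Let_def by blast
  define r where "r n = t n - dh d (proj (dred d) x)" for n
  have r_eq: "t n *\<^sub>R ?ek + proj (dred d) x + dPhi d (proj (dred d) x) = x + r n *\<^sub>R ?ek" for n
    using xd(2) by (simp add: graph_map_def edge_fun_def r_def algebra_simps)
  have "open (dU d')" using bd' by (simp add: is_bdatum_def)
  then have "eventually (\<lambda>n. x + r n *\<^sub>R ?ek \<in> dU d') sequentially"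
    using topological_tendstoD[OF t(2)] x(3) by (simp only: r_eq)
  then obtain n0 where n0: "\<And>n. n \<ge> n0 \<Longrightarrow> x + r n *\<^sub>R ?ek \<in> dU d'"
    by (auto simp: eventually_sequentially)
  define s where "s n = r (n + n0)" for n
  define y where "y n = x + s n *\<^sub>R ?ek" for n
  have y_lim: "y \<longlonglongrightarrow> x"
    using LIMSEQ_ignore_initial_segment[OF t(2), of n0] by (simp add: r_eq y_def[abs_def] s_def)
  have y_int: "y n \<in> interior_pts I0 S D" "y n \<in> dU d" "y n \<in> dU d'" for n
    using t(1)[of "n + n0"] n0[of "n + n0"] by (simp_all add: r_eq y_def s_def)
  then have yD: "y n \<in> D \<inter> dU d" "y n \<in> D \<inter> dU d'" for n by (auto simp: interior_pts_def)
  have yd: "y n \<in> chart_dom d" "y n \<in> chart_dom d'" for n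
    using collar_fix(1)[OF bd yD(1)] collar_fix(1)[OF bd' yD(2)] by blast+

  \<comment> \<open>the limit of the positive determinants cannot vanish, as the determinant of the opposite
    transition also has a limit\<close>
  define \<delta> where "\<delta> z = op_det ?A ?B (\<lambda>v. proj ?B (Q z v))" for z
  define \<delta>' where "\<delta>' z = op_det ?B ?A (\<lambda>v. proj ?A (Q' z v))" for z
  have "(\<lambda>n. \<delta> (y n)) \<longlonglongrightarrow> \<delta> x"
    unfolding \<delta>_def
    by (rule op_det_tendsto[OF simAB Q(2)[OF yd(1)] Q(2)[OF xd(1)]],
        rule continuous_on_tendsto_compose[OF Q(4) y_lim xd(1)]) (use yd in auto)
  moreover have "(\<lambda>n. \<delta>' (y n)) \<longlonglongrightarrow> \<delta>' x"
    unfolding \<delta>'_def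
    by (rule op_det_tendsto[OF simBA Q'(2)[OF yd(2)] Q'(2)[OF xd'(1)]],
        rule continuous_on_tendsto_compose[OF Q'(4) y_lim xd'(1)]) (use yd in auto)
  moreover have \<delta>_y: "\<delta> (y n) > 0" "\<delta> (y n) * \<delta>' (y n) = 1" for n
    using collar_det_interior[OF A D ori d d' y_int Q(1)[OF yd(1)] Q(2)[OF yd(1)]
        Q'(1)[OF yd(2)] Q'(2)[OF yd(2)]] by (simp_all add: \<delta>_def \<delta>'_def)
  ultimately have "\<delta> x \<ge> 0" "(\<lambda>n. 1) \<longlonglongrightarrow> \<delta> x * \<delta>' x"
    using LIMSEQ_le_const[of "\<lambda>n. \<delta> (y n)" "\<delta> x" 0]
      tendsto_mult[of "\<lambda>n. \<delta> (y n)" "\<delta> x" sequentially "\<lambda>n. \<delta>' (y n)" "\<delta>' x"]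
    by (auto simp: less_imp_le)
  then have "\<delta> x * \<delta>' x = 1" using LIMSEQ_unique tendsto_const by blast
  with \<open>\<delta> x \<ge> 0\<close> have \<delta>_pos: "\<delta> x > 0" by (cases "\<delta> x = 0") auto

  \<comment> \<open>\<open>c\<close> is the derivative at \<open>x\<close>, in the direction of \<open>e\<^sub>k\<close>, of the signed height over the boundary
    as seen from the second datum; both data know on which side the interior points lie\<close>
  define \<gamma> where "\<gamma> z = inner (z - edge_map d' z) ?el" for z
  define c where "c = inner (?ek - P' ?ek) ?el"
  have \<gamma>x: "\<gamma> x = 0" by (simp add: \<gamma>_def xd'(2))
  have \<gamma>_y: "(-1) ^ dpos d' * \<gamma> (y n) > 0" for n
    using interior_side[OF d', of "y n"] y_int by (simp add: \<gamma>_def)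
  have s_pos: "(-1) ^ dpos d * s n > 0" for n
  proof -
    have "proj (dred d) (y n) = proj (dred d) x"
      by (simp add: y_def proj_add proj_scale proj_basis dred_subset)
    then have "edge_map d (y n) = edge_map d x" by (rule graph_map_cong_proj)
    then have "y n - edge_map d (y n) = s n *\<^sub>R ?ek" by (simp add: y_def xd(2))
    then show ?thesis
      using interior_side[OF d, of "y n"] y_int by (simp add: inner_basis_basis)
  qed
  have "(\<lambda>n. inner (y n - x) ?ek) \<longlonglongrightarrow> inner (x - x) ?ek" by (intro tendsto_intros y_lim)
  then have s_lim: "s \<longlonglongrightarrow> 0" by (simp add: y_def inner_basis_basis)
  have "(\<gamma> has_derivative (\<lambda>v. inner (v - P' v) ?el)) (at x)"
    unfolding \<gamma>_def using P'(1) by (auto intro!: derivative_eq_intros)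
  moreover have "s n \<noteq> 0" for n using s_pos[of n] by auto
  ultimately have "(\<lambda>n. (\<gamma> (x + s n *\<^sub>R ?ek) - \<gamma> x) / s n) \<longlonglongrightarrow> c"
    unfolding c_def by (intro directional_slope_tendsto s_lim)
  then have "(\<lambda>n. \<gamma> (y n) / s n) \<longlonglongrightarrow> c" by (simp add: y_def \<gamma>x)
  then have "(\<lambda>n. (-1) ^ (dpos d + dpos d') * (\<gamma> (y n) / s n)) \<longlonglongrightarrow> (-1) ^ (dpos d + dpos d') * c"
    by (rule tendsto_mult_left)
  moreover have "(-1) ^ (dpos d + dpos d') * (\<gamma> (y n) / s n) \<ge> 0" for n
  proof -
    have "0 < ((-1) ^ dpos d' * \<gamma> (y n)) / ((-1) ^ dpos d * s n)"
      using \<gamma>_y s_pos by (rule divide_pos_pos)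
    then show ?thesis by (simp add: power_add minus_one_power_iff split: if_splits)
  qed
  ultimately have c_sign: "(-1) ^ (dpos d + dpos d') * c \<ge> 0"
    by (intro LIMSEQ_le_const) auto

  \<comment> \<open>the boundary lies in the first collar, and near \<open>x\<close> it is the same set for both data\<close>
  have QP: "Q x (P v) = P v" for v
    by (rule retraction_derivative_fixes[OF P(1) Q(1)[OF xd(1)] xd(2) open_chart_dom[OF bd] xd(1)])
      (use edge_in[OF d] collar_fix(2)[OF bd] in \<open>auto simp: boundary_pts_def\<close>)
  define N where "N = chart_dom d \<inter> edge_map d -` dU d'"
  have N: "open N" "x \<in> N"
    unfolding N_def
    using xd x(3) continuous_open_preimage[OF continuous_on_derivative[OF Pe] open_chart_dom[OF bd] \<open>open (dU d')\<close>]
    by simp_all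
  have P'P: "P' (P v) = P v" for v
    by (rule retraction_derivative_fixes[OF P(1) P'(1) xd(2) N])
      (use edge_in[OF d] edge_fix(2)[OF d'] in \<open>auto simp: N_def\<close>)
  define m where "m = op_det (dred d) (dred d') (\<lambda>v. proj (dred d') (P v))"
  let ?p = "card (?A \<inter> {..<?k})" and ?q = "card (?B \<inter> {..<?l})"
  have "\<delta> x = (-1) ^ (?p + ?q) * inner (Q x ?ek - P' (Q x ?ek)) ?el * m"
    unfolding \<delta>_def m_def dred_def
    by (rule op_det_hypersurface[OF simAB bdatum_index(1)[OF bd] bdatum_index(1)[OF bd'] Q(2)[OF xd(1)]])
      (use P(2) P'(2) QP P'P in \<open>simp_all add: dred_def\<close>)
  then have \<delta>m: "(-1) ^ (?p + ?q) * c * m > 0" using \<delta>_pos Q(3)[OF xd(1)] by (simp add: c_def)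
  have "(-1) ^ ((?p + ?q) + (dpos d + dpos d')) * m > 0"
    by (rule sign_cancel[OF \<delta>m c_sign])
  also have "(-1) ^ ((?p + ?q) + (dpos d + dpos d')) = (-1) ^ (dpos d + ?p) * ((-1) ^ (dpos d' + ?q) :: real)"
    by (simp add: power_add)
  finally have "(-1) ^ (dpos d + ?p) * (-1) ^ (dpos d' + ?q) * m > 0" .
  then show ?thesis by (simp add: m_def bdatum_index(5)[OF bd] bdatum_index(5)[OF bd'])
qed

section \<open>The boundary as an oriented surface\<close>

lemma boundary_triple:
  assumes d: "admissible I0 S D x d" and i: "i \<in> I0"
  shows "(boundary_pts I0 D \<inter> dU d, dred d, edge_fun d) \<in> local_triples (- I0 \<union> {i}) (boundary_pts I0 D)"
    and "I0 - {i} \<noteq> {}"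
proof -
  note bd = admissible_bdatum[OF d]
  have "sim (dset d - {dk d}) (I0 - {i})"
    by (rule sim_remove) (use bdatum_index[OF bd] i in \<open>simp_all add: dred_def\<close>)
  then have sim: "sim (dred d) (I0 - {i})" by (simp add: dred_def)
  then show "I0 - {i} \<noteq> {}" by (simp add: sim_def)
  have "- (- I0 \<union> {i}) = I0 - {i}" by auto
  with sim have "dred d \<in> Gam (- (- I0 \<union> {i}))" by (simp add: Gam_def)
  moreover have "x \<in> boundary_pts I0 D \<inter> dU d"
    using d by (auto simp: admissible_def boundary_pts_def is_bdatum_def)
  moreover have "open (dU d)" using bd by (simp add: is_bdatum_def)
  moreover have "\<exists>g. homeomorphism (boundary_pts I0 D \<inter> dU d) (dV d) (proj (dred d)) g"
    using d unfolding admissible_def Let_def by blast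
  moreover have "edge_fun d ` dV d \<subseteq> subsp (- dred d)" using edge_fun_subsp[OF bd] by blast
  ultimately show "(boundary_pts I0 D \<inter> dU d, dred d, edge_fun d) \<in>
      local_triples (- I0 \<union> {i}) (boundary_pts I0 D)"
    using C1_on_edge_fun[OF bd] admissible_edge[OF d] unfolding local_triples_def by blast
qed

lemma A1_eq:
  "A1 I0 S D = {(boundary_pts I0 D \<inter> dU d, seq_del (dK d) (dpos d), edge_fun d) | d x. admissible I0 S D x d}"
  by (simp add: A1_def edge_fun_def[abs_def])

theorem proposition5p1:
  fixes a :: "nat \<Rightarrow> real" and I0 :: "nat set" and S D :: "ell2 set" and A :: "triple set"
  assumes "\<And>i. a i > 0" and "summable a"
    and "I0 \<noteq> {}"
    and "surface_codim (- I0) S" and "C1_structure (- I0) S A"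
    and "sigma_finite_measure (surface_measure a (- I0) S)"
    and "oriented I0 A"
    and "\<And>\<tau>. \<tau> \<in> A \<Longrightarrow> bounded_triple a \<tau>"
    and "region_with_boundary I0 S D"
    and "data_oriented I0 S A D"
  shows "(\<exists>i\<in>I0. C1_structure (- I0 \<union> {i}) (boundary_pts I0 D) (abs_A1 I0 S D) \<and>
            (boundary_pts I0 D \<noteq> {} \<longrightarrow> surface_codim (- I0 \<union> {i}) (boundary_pts I0 D))) \<and>
    (\<forall>(W, L, f) \<in> A1 I0 S D. \<forall>(W', L', g) \<in> A1 I0 S D. W \<inter> W' \<noteq> {} \<longrightarrow>
       (\<forall>x \<in> W \<inter> W'.
          transition (ran L') f differentiable (at (proj (ran L) x) within subsp (ran L)) \<and>
          seq_sign L * seq_sign L' * transition_det (ran L) f (ran L') x > 0))"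
proof
  let ?B = "boundary_pts I0 D"
  \<comment> \<open>any \<open>i\<close> will do: the coordinate sets of the data arise from sets similar to \<open>I0\<close> by removing
    one element, so they are similar to \<open>I0 - {i}\<close> for every \<open>i\<close>\<close>
  obtain i where i: "i \<in> I0" using assms(3) by blast
  have triples: "abs_A1 I0 S D = {(?B \<inter> dU d, dred d, edge_fun d) | d x. admissible I0 S D x d}"
    unfolding abs_A1_def A1_eq
    using bdatum_index(3)[OF admissible_bdatum] by (fastforce simp: image_iff)
  have sub: "abs_A1 I0 S D \<subseteq> local_triples (- I0 \<union> {i}) ?B"
    unfolding triples using boundary_triple(1)[OF _ i] by blast
  have cover: "\<exists>(W, I, f) \<in> abs_A1 I0 S D. x \<in> W" if x: "x \<in> ?B" for x
  proof -
    obtain d where d: "admissible I0 S D x d"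
      using assms(9) x by (auto simp: region_with_boundary_def)
    moreover have "x \<in> dU d" using admissible_bdatum[OF d] by (simp add: is_bdatum_def)
    ultimately show ?thesis using x unfolding triples by blast
  qed
  have "C1_structure (- I0 \<union> {i}) ?B (abs_A1 I0 S D)"
    unfolding C1_structure_def
  proof (intro conjI sub equalityI subsetI)
    fix x assume "x \<in> (\<Union>(W, I, f)\<in>abs_A1 I0 S D. W)"
    then show "x \<in> ?B" unfolding triples by auto
  next
    fix x assume "x \<in> ?B"
    then show "x \<in> (\<Union>(W, I, f)\<in>abs_A1 I0 S D. W)" using cover by fastforce
  qed
  moreover have "surface_codim (- I0 \<union> {i}) ?B" if ne: "?B \<noteq> {}"
  proof -
    obtain x where "x \<in> ?B" using ne by blast
    then obtain d where "admissible I0 S D x d"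
      using assms(9) by (auto simp: region_with_boundary_def)
    then have "I0 - {i} \<noteq> {}" by (rule boundary_triple(2)[OF _ i])
    then have "- (- I0 \<union> {i}) \<noteq> {}" by blast
    moreover have "\<forall>x\<in>?B. \<exists>(W, I, f)\<in>local_triples (- I0 \<union> {i}) ?B. x \<in> W"
      using cover sub by blast
    ultimately show ?thesis using ne unfolding surface_codim_def by blast
  qed
  ultimately show "\<exists>i\<in>I0. C1_structure (- I0 \<union> {i}) ?B (abs_A1 I0 S D) \<and>
      (?B \<noteq> {} \<longrightarrow> surface_codim (- I0 \<union> {i}) ?B)" using i by blast
next
  have DS: "D \<subseteq> S" using assms(9) by (simp add: region_with_boundary_def)
  have "transition (ran (seq_del (dK d') (dpos d'))) (edge_fun d) differentiable
        (at (proj (ran (seq_del (dK d) (dpos d))) x) within subsp (ran (seq_del (dK d) (dpos d)))) \<and>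
      seq_sign (seq_del (dK d) (dpos d)) * seq_sign (seq_del (dK d') (dpos d')) *
        transition_det (ran (seq_del (dK d) (dpos d))) (edge_fun d) (ran (seq_del (dK d') (dpos d'))) x > 0"
    if d: "admissible I0 S D x0 d" and d': "admissible I0 S D x1 d'"
      and x: "x \<in> boundary_pts I0 D" "x \<in> dU d" "x \<in> dU d'" for d d' x0 x1 x
  proof -
    note bd = admissible_bdatum[OF d] and bd' = admissible_bdatum[OF d']
    have "x \<in> chart_dom d" using edge_fix(1)[OF d] x by blast
    then obtain P where P: "(edge_map d has_derivative P) (at x)" "tangent_proj (dred d) P"
      using edge_derivative[OF bd] by metis
    show ?thesis
      unfolding bdatum_index(3)[OF bd] bdatum_index(3)[OF bd'] transition_graph_map(2)[OF P(1)]
      using transition_graph_map(1)[OF P(1)]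
        boundary_transition_sign[OF assms(5) DS assms(10) d d' x P] by blast
  qed
  then show "\<forall>(W, L, f) \<in> A1 I0 S D. \<forall>(W', L', g) \<in> A1 I0 S D. W \<inter> W' \<noteq> {} \<longrightarrow>
       (\<forall>x \<in> W \<inter> W'.
          transition (ran L') f differentiable (at (proj (ran L) x) within subsp (ran L)) \<and>
          seq_sign L * seq_sign L' * transition_det (ran L) f (ran L') x > 0)"
    unfolding A1_eq by blast
qed

end
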